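(* Let $f$ be a continuously differentiable convex function with a locally Lipschitz continuous gradient, such that $\operatorname{dom}(f)$ contains all non-singular density matrices, and consider minimizing $f$ over the set $\mathcal{D}$ of density matrices by the exponentiated gradient method with Armijo line search (the algorithm described in the context), with any parameters $\alpha>0$, $r\in(0,1)$, $\tau\in(0,1)$ and any non-singular initial density matrix $\rho_0$. Then the following statements hold. 1. The Armijo line search (the inner while-loop) terminates in finitely many steps (at every iteration $k$). 2. $\rho_k\in\mathcal{D}$ for all $k$. 3. $f(\rho_{k+1})\le f(\rho_k)$ for all $k$. 4. The sequence $(\rho_k)_{k\in\mathbb{N}}$ has at least one limit point. 5. Every limit point of $(\rho_k)_{k\in\mathbb{N}}$ minimizes $f$ on $\mathcal{D}$.
   Context: Fix $d\in\mathbb{N}$ and let $\mathcal{D}=\{\rho\in\mathbb{C}^{d\times d}:\rho=\rho^H,\ \rho\ge 0,\ \operatorname{Tr}(\rho)=1\}$ be the set of density matrices. The interior of $\mathcal{D}$ is understood as the set of non-singular (positive definite) density matrices. The inner product is $\langle X,Y\rangle=\operatorname{Tr}(X^HY)$. The function $f$ is a convex function of Hermitian matrices with values in $\mathbb{R}\cup\{+\infty\}$, $\operatorname{dom}(f)=\{x: f(x)<+\infty\}$, and $f$ is continuously differentiable on $\operatorname{dom}(f)$. Its gradient $f'(x)$ at $x\in\operatorname{dom}(f)$ is the unique (Hermitian) matrix with $f(y)\ge f(x)+\langle f'(x),y-x\rangle$ for all $y\in\operatorname{dom}(f)$. The function $f$ is continuous on $\mathcal{D}$ as a map into $\mathbb{R}\cup\{+\infty\}$.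 "$f$ has a locally Lipschitz continuous gradient" means: for every $x\in\operatorname{dom}(f)$ there is a neighborhood of $x$ in $\operatorname{dom}(f)$ on which $f'$ is Lipschitz continuous. For a non-singular density matrix $\rho$ and $a>0$, put $\rho(a)=c^{-1}\exp[\log(\rho)-a f'(\rho)]$, where $\exp,\log$ are the matrix exponential and logarithm and $c>0$ normalizes the trace of $\rho(a)$ to $1$. Write $\rho_k(a)$ for this matrix with $\rho=\rho_k$. Exponentiated gradient method with Armijo line search. Inputs: $\alpha>0$, $r\in(0,1)$, $\tau\in(0,1)$, and a non-singular $\rho_0\in\mathcal{D}$. For $k=0,1,2,\dots$: set $\alpha_k\leftarrow\alpha$; while $f(\rho_k(\alpha_k))>f(\rho_k)+\tau\langle f'(\rho_k),\rho_k(\alpha_k)-\rho_k\rangle$, replace $\alpha_k\leftarrow r\alpha_k$; then set $\rho_{k+1}\leftarrow\rho_k(\alpha_k)$. *)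

theory Defs
  imports "HOL-Analysis.Analysis" "HOL-Library.While_Combinator"
begin

definition conj_transpose :: "complex ^ 'n ^ 'n \<Rightarrow> complex ^ 'n ^ 'n" where
  "conj_transpose A = (\<chi> i j. cnj (A $ j $ i))"

definition hermitian :: "complex ^ 'n ^ 'n \<Rightarrow> bool" where
  "hermitian A \<longleftrightarrow> conj_transpose A = A"

definition pos_semidef :: "complex ^ 'n ^ 'n \<Rightarrow> bool" where
  "pos_semidef A \<longleftrightarrow> hermitian A \<and> (\<forall>v. 0 \<le> Re (\<Sum>i\<in>UNIV. cnj (v $ i) * (A *v v) $ i))"

definition hs_inner :: "complex ^ 'n ^ 'n \<Rightarrow> complex ^ 'n ^ 'n \<Rightarrow> complex" where
  "hs_inner X Y = trace (conj_transpose X ** Y)"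

definition density_matrices :: "(complex ^ 'n ^ 'n) set" where
  "density_matrices = {\<rho>. pos_semidef \<rho> \<and> trace \<rho> = 1}"

definition nonsingular_density_matrices :: "(complex ^ 'n ^ 'n) set" where
  "nonsingular_density_matrices = {\<rho> \<in> density_matrices. invertible \<rho>}"

(* The type class operations * and ^ act componentwise on vectors, hence the explicit
   iteration of the matrix product. *)
definition mat_power :: "complex ^ 'n ^ 'n \<Rightarrow> nat \<Rightarrow> complex ^ 'n ^ 'n" where
  "mat_power A n = (((**) A) ^^ n) (mat 1)"

definition mat_exp :: "complex ^ 'n ^ 'n \<Rightarrow> complex ^ 'n ^ 'n" where
  "mat_exp A = (\<Sum>n. (1 / fact n) *\<^sub>R mat_power A n)"

(* Only meaningful for positive definite A, where exactly one Hermitian logarithm exists. *)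
definition mat_log :: "complex ^ 'n ^ 'n \<Rightarrow> complex ^ 'n ^ 'n" where
  "mat_log A = (THE L. hermitian L \<and> mat_exp L = A)"

(* Extended-valued functions of Hermitian matrices are represented by functions on all
   matrices; their values at non-Hermitian matrices are never used. *)

definition edom :: "(complex ^ 'n ^ 'n \<Rightarrow> ereal) \<Rightarrow> (complex ^ 'n ^ 'n) set" where
  "edom f = {x. hermitian x \<and> f x < \<infinity>}"

(* With f > -\<infinity> and 0 * \<infinity> = 0 the right-hand side is always well defined. *)
definition convex_ereal :: "(complex ^ 'n ^ 'n \<Rightarrow> ereal) \<Rightarrow> bool" where
  "convex_ereal f \<longleftrightarrow>
     (\<forall>x. hermitian x \<longrightarrow> f x \<noteq> -\<infinity>) \<and>
     (\<forall>x y. \<forall>t\<in>{0..1}. hermitian x \<longrightarrow> hermitian y \<longrightarrow>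
        f ((1 - t) *\<^sub>R x + t *\<^sub>R y) \<le> ereal (1 - t) * f x + ereal t * f y)"

definition is_gradient :: "(complex ^ 'n ^ 'n \<Rightarrow> ereal) \<Rightarrow> complex ^ 'n ^ 'n \<Rightarrow> complex ^ 'n ^ 'n \<Rightarrow> bool" where
  "is_gradient f x G \<longleftrightarrow>
     hermitian G \<and> (\<forall>y\<in>edom f. f y \<ge> f x + ereal (Re (hs_inner G (y - x))))"

definition gradient :: "(complex ^ 'n ^ 'n \<Rightarrow> ereal) \<Rightarrow> complex ^ 'n ^ 'n \<Rightarrow> complex ^ 'n ^ 'n" where
  "gradient f x = (THE G. is_gradient f x G)"

definition continuously_differentiable :: "(complex ^ 'n ^ 'n \<Rightarrow> ereal) \<Rightarrow> bool" where
  "continuously_differentiable f \<longleftrightarrow>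
     (\<forall>x\<in>edom f. (\<exists>!G. is_gradient f x G) \<and>
        ((\<lambda>y. real_of_ereal (f y)) has_derivative (\<lambda>h. Re (hs_inner (gradient f x) h)))
          (at x within edom f)) \<and>
     continuous_on (edom f) (gradient f)"

definition locally_lipschitz_gradient :: "(complex ^ 'n ^ 'n \<Rightarrow> ereal) \<Rightarrow> bool" where
  "locally_lipschitz_gradient f \<longleftrightarrow>
     (\<forall>x\<in>edom f. \<exists>U L. open U \<and> x \<in> U \<and> L-lipschitz_on (U \<inter> edom f) (gradient f))"

definition eg_update :: "(complex ^ 'n ^ 'n \<Rightarrow> ereal) \<Rightarrow> complex ^ 'n ^ 'n \<Rightarrow> real \<Rightarrow> complex ^ 'n ^ 'n" where
  "eg_update f \<rho> a =
     (let E = mat_exp (mat_log \<rho> - a *\<^sub>R gradient f \<rho>) in inverse (Re (trace E)) *\<^sub>R E)"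

(* None means that the loop does not terminate. *)
definition armijo_search ::
  "(complex ^ 'n ^ 'n \<Rightarrow> ereal) \<Rightarrow> real \<Rightarrow> real \<Rightarrow> real \<Rightarrow> complex ^ 'n ^ 'n \<Rightarrow> real option" where
  "armijo_search f \<alpha> r \<tau> \<rho> =
     while_option
       (\<lambda>a. f (eg_update f \<rho> a) >
              f \<rho> + ereal (\<tau> * Re (hs_inner (gradient f \<rho>) (eg_update f \<rho> a - \<rho>))))
       (\<lambda>a. r * a) \<alpha>"

primrec eg_iterate ::
  "(complex ^ 'n ^ 'n \<Rightarrow> ereal) \<Rightarrow> real \<Rightarrow> real \<Rightarrow> real \<Rightarrow> complex ^ 'n ^ 'n \<Rightarrow> nat \<Rightarrow> complex ^ 'n ^ 'n" where
  "eg_iterate f \<alpha> r \<tau> \<rho>\<^sub>0 0 = \<rho>\<^sub>0"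
| "eg_iterate f \<alpha> r \<tau> \<rho>\<^sub>0 (Suc k) =
     eg_update f (eg_iterate f \<alpha> r \<tau> \<rho>\<^sub>0 k)
       (the (armijo_search f \<alpha> r \<tau> (eg_iterate f \<alpha> r \<tau> \<rho>\<^sub>0 k)))"

definition seq_limit_point :: "(nat \<Rightarrow> 'a::topological_space) \<Rightarrow> 'a \<Rightarrow> bool" where
  "seq_limit_point X l \<longleftrightarrow> (\<exists>s. strict_mono s \<and> (X \<circ> s) \<longlonglongrightarrow> l)"

end

theory Submission
  imports Defs
begin

text \<open>Write \<open>g\<close> for the gradient at the current iterate \<open>\<rho>\<close>, \<open>\<rho>(a)\<close> for the exponentiated gradient
update with step size \<open>a\<close>, and \<open>\<Delta> = \<langle>g, \<rho> - \<rho>(a)\<rangle>\<close> for the decrease predicted by \<open>g\<close>.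
The logarithms satisfy \<open>log \<rho>(a) = log \<rho> - a g - t I\<close> for some scalar \<open>t\<close>, and scalars are
invisible when two matrices of the same trace are compared. Everything rests on two matrix
inequalities, fed with this identity.

Cocoercivity of the exponential (\<open>mat_exp_cocoercive\<close>) gives \<open>\<parallel>\<rho>(a) - \<rho>\<parallel>\<^sup>2 \<le> 2 a \<Delta>\<close>. Hence
\<open>\<rho>(a)\<close> stays close to \<open>\<rho>\<close> for small \<open>a\<close>, and the gradient inequality at \<open>\<rho>(a)\<close> together with a
local Lipschitz constant \<open>K\<close> of the gradient yields
\<open>f(\<rho>(a)) - f(\<rho>) \<le> - \<Delta> + K \<parallel>\<rho>(a) - \<rho>\<parallel>\<^sup>2 \<le> - (1 - 2 a K) \<Delta>\<close>. So the Armijo condition holds as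
soon as \<open>2 a K \<le> 1 - \<tau>\<close>. The iterates remain in the sublevel set of the initial value, which is
compact because \<open>f\<close> is continuous on the compact set of density matrices, and which is contained
in the domain of \<open>f\<close>. A finite cover of it makes the threshold uniform
(\<open>armijo_condition_uniformly\<close>), so every line search terminates and the accepted step sizes
\<open>\<beta>\<^sub>k\<close> are bounded below by some \<open>\<beta>\<^sub>0 > 0\<close>.

Convexity of the trace exponential (\<open>trace_exp_gradient_inequality\<close>) gives the mirror descent
inequality \<open>- \<langle>\<sigma>, log \<rho>\<^sub>k\<^sub>+\<^sub>1\<rangle> \<le> - \<langle>\<sigma>, log \<rho>\<^sub>k\<rangle> + \<beta>\<^sub>k \<langle>g\<^sub>k, \<sigma> - \<rho>\<^sub>k\<^sub>+\<^sub>1\<rangle>\<close> for every density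
matrix \<open>\<sigma>\<close>. If \<open>\<sigma>\<close> had a value smaller by \<open>c > 0\<close> than a limit point, then
\<open>\<langle>g\<^sub>k, \<sigma> - \<rho>\<^sub>k\<rangle> \<le> - c\<close> for all \<open>k\<close>. Since \<open>\<tau> \<Delta>\<^sub>k \<le> f(\<rho>\<^sub>k) - f(\<rho>\<^sub>k\<^sub>+\<^sub>1)\<close>, the Lyapunov function
\<open>- \<langle>\<sigma>, log \<rho>\<^sub>k\<rangle> + (\<alpha>/\<tau>) f(\<rho>\<^sub>k)\<close> would drop by at least \<open>\<beta>\<^sub>0 c\<close> in each step, although it is
bounded below. Hence limit points are minimizers. Limit points may be singular; only
logarithms of the iterates ever enter.

Both matrix inequalities, and injectivity of the exponential on Hermitian matrices, reduce to
scalar ones. The space of complex vectors is regarded as a real Euclidean space, where a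
Hermitian matrix is a self-adjoint operator and has a real orthonormal eigenbasis. For two
Hermitian matrices with eigenbases \<open>B\<close> and \<open>C\<close> the inner products in question become sums over
\<open>b \<in> B\<close>, \<open>c \<in> C\<close> with the nonnegative weights \<open>(b \<bullet> c)\<^sup>2\<close> (\<open>inner_diff_diagonal_on\<close>), and the
inequalities can be checked term by term.\<close>

section \<open>Orthonormal eigenbases of self-adjoint operators\<close>

definition orthonormal_basis :: "'a::euclidean_space set \<Rightarrow> bool" where
  "orthonormal_basis B \<longleftrightarrow> pairwise orthogonal B \<and> (\<forall>b\<in>B. norm b = 1) \<and> span B = UNIV"

lemma orthonormal_basis_finite: "orthonormal_basis B \<Longrightarrow> finite B"
  by (simp add: orthonormal_basis_def pairwise_orthogonal_imp_finite)

lemma orthonormal_basis_expansion: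
  assumes "orthonormal_basis B"
  shows "(\<Sum>b\<in>B. (x \<bullet> b) *\<^sub>R b) = x"
  using assms orthonormal_basis_finite[OF assms]
  by (intro orthonormal_basis_expand) (auto simp: orthonormal_basis_def)

lemma inner_orthonormal_basis:
  assumes "orthonormal_basis B"
  shows "x \<bullet> y = (\<Sum>b\<in>B. (x \<bullet> b) * (y \<bullet> b))"
proof -
  have "(\<Sum>b\<in>B. (x \<bullet> b) *\<^sub>R b) \<bullet> y = (\<Sum>b\<in>B. (x \<bullet> b) * (y \<bullet> b))"
    unfolding inner_sum_left by (simp add: inner_commute)
  then show ?thesis
    by (simp add: orthonormal_basis_expansion[OF assms])
qed

lemma orthonormal_basis_inner:
  assumes "orthonormal_basis B" "b \<in> B" "c \<in> B"
  shows "b \<bullet> c = (if b = c then 1 else 0)"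
  using assms by (auto simp: orthonormal_basis_def pairwise_def orthogonal_def norm_eq_1)

lemma orthonormal_basis_Basis: "orthonormal_basis Basis"
  by (auto simp: orthonormal_basis_def pairwise_def orthogonal_def inner_Basis)

lemma linear_eq_on_orthonormal_basis:
  assumes "orthonormal_basis B" "linear F" "linear G" "\<And>b. b \<in> B \<Longrightarrow> F b = G b"
  shows "F x = G x"
  using linear_eq_on[of F G x B] assms by (auto simp: orthonormal_basis_def)

text \<open>Basis independence of the trace of \<open>F\<^sup>* G\<close>: expanding \<open>b\<close> in \<open>C\<close> and summing over \<open>B\<close> first turns
the coefficients into Parseval sums for pairs of elements of \<open>C\<close>.\<close>

lemma sum_inner_orthonormal_basis_eq:
  fixes F G :: "'a::euclidean_space \<Rightarrow> 'b::real_inner"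
  assumes B: "orthonormal_basis B" and C: "orthonormal_basis C" and F: "linear F" and G: "linear G"
  shows "(\<Sum>b\<in>B. F b \<bullet> G b) = (\<Sum>c\<in>C. F c \<bullet> G c)"
proof -
  have expand: "H b = (\<Sum>c\<in>C. (b \<bullet> c) *\<^sub>R H c)" if "linear H" for H :: "'a \<Rightarrow> 'b" and b
  proof -
    have "H b = H (\<Sum>c\<in>C. (b \<bullet> c) *\<^sub>R c)"
      by (simp add: orthonormal_basis_expansion[OF C])
    then show ?thesis
      by (simp add: linear_sum[OF that] linear_cmul[OF that])
  qed
  have "(\<Sum>b\<in>B. F b \<bullet> G b)
      = (\<Sum>b\<in>B. \<Sum>c\<in>C. \<Sum>c'\<in>C. (b \<bullet> c) * (b \<bullet> c') * (F c' \<bullet> G c))"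
    by (subst expand[OF F], subst expand[OF G])
       (simp add: inner_sum_left inner_sum_right sum_distrib_left mult_ac)
  also have "\<dots> = (\<Sum>c\<in>C. \<Sum>c'\<in>C. (\<Sum>b\<in>B. (c \<bullet> b) * (c' \<bullet> b)) * (F c' \<bullet> G c))"
    by (subst sum.swap, rule sum.cong[OF refl], subst sum.swap)
       (simp add: sum_distrib_right inner_commute)
  also have "\<dots> = (\<Sum>c\<in>C. \<Sum>c'\<in>C. (c \<bullet> c') * (F c' \<bullet> G c))"
    by (simp add: inner_orthonormal_basis[OF B, symmetric])
  also have "\<dots> = (\<Sum>c\<in>C. F c \<bullet> G c)"
    by (intro sum.cong refl)
       (simp add: orthonormal_basis_inner[OF C] orthonormal_basis_finite[OF C] if_distrib[of "\<lambda>x. x * _"]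
         sum.delta cong: if_cong)
  finally show ?thesis .
qed

text \<open>First-order optimality: moving from \<open>v\<close> in the direction of the residual \<open>w = T v - \<mu> v\<close> changes
\<open>x \<bullet> T x - \<mu> (x \<bullet> x)\<close> by \<open>2 t (w \<bullet> w)\<close> to first order, which a maximizer forbids unless \<open>w = 0\<close>.\<close>

lemma Rayleigh_maximizer_is_eigenvector:
  fixes T :: "'a::real_inner \<Rightarrow> 'a"
  assumes T: "linear T" and sa: "\<And>x y. T x \<bullet> y = x \<bullet> T y"
    and S: "subspace S" and inv: "\<And>x. x \<in> S \<Longrightarrow> T x \<in> S"
    and v: "v \<in> S" and max: "\<And>x. x \<in> S \<Longrightarrow> x \<bullet> T x \<le> \<mu> * (x \<bullet> x)" and eq: "v \<bullet> T v = \<mu> * (v \<bullet> v)"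
  shows "T v = \<mu> *\<^sub>R v"
proof -
  define w where "w = T v - \<mu> *\<^sub>R v"
  have w: "w \<in> S"
    using S inv v by (simp add: w_def subspace_diff subspace_scale)
  define c where "c = w \<bullet> T w - \<mu> * (w \<bullet> w)"
  have wv: "w \<bullet> T v - \<mu> * (w \<bullet> v) = w \<bullet> w"
    by (simp add: w_def inner_diff_right inner_diff_left algebra_simps)
  \<comment> \<open>Inserting \<open>v + t w\<close> and dividing by \<open>t\<close>.\<close>
  have quad: "2 * (w \<bullet> w) + t * c \<le> 0" if "t > 0" for t :: real
  proof -
    have "v + t *\<^sub>R w \<in> S"
      using S v w by (simp add: subspace_add subspace_scale)
    from max[OF this]
    have "v \<bullet> T v + 2 * t * (w \<bullet> T v) + t\<^sup>2 * (w \<bullet> T w)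
        \<le> \<mu> * (v \<bullet> v + 2 * t * (w \<bullet> v) + t\<^sup>2 * (w \<bullet> w))"
      using sa[of v w]
      by (simp add: linear_add[OF T] linear_cmul[OF T] inner_add_left inner_add_right
          inner_commute power2_eq_square algebra_simps)
    then have "2 * t * (w \<bullet> T v - \<mu> * (w \<bullet> v)) + t\<^sup>2 * c \<le> 0"
      using eq by (simp add: c_def algebra_simps)
    then have "t * (2 * (w \<bullet> w) + t * c) \<le> 0"
      unfolding wv by (simp add: power2_eq_square algebra_simps)
    then show ?thesis
      using that by (simp add: mult_le_0_iff)
  qed
  have "((\<lambda>t. 2 * (w \<bullet> w) + t * c) \<longlongrightarrow> 2 * (w \<bullet> w) + 0 * c) (at_right 0)"
    by (intro tendsto_intros)
  then have "2 * (w \<bullet> w) + 0 * c \<le> 0"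
    by (rule tendsto_upperbound)
       (auto simp: eventually_at_right_field intro!: exI[of _ 1] quad)
  then have "w = 0"
    using inner_gt_zero_iff[of w] by linarith
  then show ?thesis by (simp add: w_def)
qed

text \<open>Take an orthonormal set of eigenvectors of maximal cardinality. If it did not span, its orthogonal
complement would be an invariant subspace, and a maximizer of the Rayleigh quotient on its
unit sphere would be one more eigenvector.\<close>

lemma selfadjoint_orthonormal_eigenbasis:
  fixes T :: "'a::euclidean_space \<Rightarrow> 'a"
  assumes T: "linear T" and sa: "\<And>x y. T x \<bullet> y = x \<bullet> T y"
  obtains B \<mu> where "orthonormal_basis B" "\<And>b. b \<in> B \<Longrightarrow> T b = \<mu> b *\<^sub>R b"
proof -
  define P where "P B \<longleftrightarrow> pairwise orthogonal B \<and> (\<forall>b\<in>B. norm b = 1 \<and> (\<exists>m. T b = m *\<^sub>R b))" for B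
  have bound: "finite B \<and> card B \<le> DIM('a)" if "P B" for B
  proof -
    have "independent B"
      using that by (intro pairwise_orthogonal_independent) (auto simp: P_def)
    then show ?thesis by (rule independent_bound)
  qed
  have "P {}"
    by (simp add: P_def pairwise_empty)
  moreover have "\<forall>B'. P B' \<longrightarrow> card B' < Suc DIM('a)"
    using bound by (auto simp: less_Suc_eq_le)
  ultimately obtain B where B: "P B" and "\<forall>B'. P B' \<longrightarrow> card B' \<le> card B"
    using ex_has_greatest_nat[of P "{}" card "Suc DIM('a)"] by auto
  then have maximal: "card B' \<le> card B" if "P B'" for B'
    using that by simp
  have "span B = UNIV"
  proof (rule ccontr)
    assume "span B \<noteq> UNIV"
    define S where "S = {x. \<forall>b\<in>B. x \<bullet> b = 0}"
    have S: "subspace S"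
      by (auto simp: S_def subspace_def inner_add_left)
    have inv: "T x \<in> S" if "x \<in> S" for x
      unfolding S_def
    proof (safe)
      fix b assume "b \<in> B"
      with B obtain m where "T b = m *\<^sub>R b" by (auto simp: P_def)
      with that \<open>b \<in> B\<close> show "T x \<bullet> b = 0"
        unfolding sa by (simp add: S_def)
    qed
    obtain z where z: "z \<noteq> 0" "z \<in> S"
    proof -
      have "span B \<subset> span UNIV"
        using \<open>span B \<noteq> UNIV\<close> by (simp add: psubset_eq)
      then obtain x where "x \<noteq> 0" "\<And>y. y \<in> span B \<Longrightarrow> orthogonal x y"
        by (rule orthogonal_to_subspace_exists_gen) blast
      then show ?thesis
        using that[of x] span_base[of _ B] by (auto simp: S_def orthogonal_def)
    qed
    have "closed S"
      using S by (rule closed_subspace)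
    then have "compact (S \<inter> sphere 0 1)"
      by (simp add: closed_Int_compact)
    moreover have "z /\<^sub>R norm z \<in> S \<inter> sphere 0 1"
      using z S by (simp add: subspace_scale)
    then have "S \<inter> sphere 0 1 \<noteq> {}"
      by blast
    moreover have "continuous_on (S \<inter> sphere 0 1) (\<lambda>x. x \<bullet> T x)"
      using T by (intro continuous_intros linear_continuous_on) (simp add: linear_conv_bounded_linear)
    ultimately obtain v where "v \<in> S \<inter> sphere 0 1"
      and "\<forall>x\<in>S \<inter> sphere 0 1. x \<bullet> T x \<le> v \<bullet> T v"
      using continuous_attains_sup[of "S \<inter> sphere 0 1" "\<lambda>x. x \<bullet> T x"] by blast
    then have v: "v \<in> S" "norm v = 1"
      and vmax: "\<And>x. x \<in> S \<Longrightarrow> norm x = 1 \<Longrightarrow> x \<bullet> T x \<le> v \<bullet> T v"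
      by auto
    have "\<exists>m. T v = m *\<^sub>R v"
    proof (intro exI, rule Rayleigh_maximizer_is_eigenvector[OF T sa S inv v(1)])
      show "x \<bullet> T x \<le> (v \<bullet> T v) * (x \<bullet> x)" if "x \<in> S" for x
      proof (cases "x = 0")
        case False
        have "(x /\<^sub>R norm x) \<bullet> T (x /\<^sub>R norm x) \<le> v \<bullet> T v"
          using False that S by (intro vmax) (auto simp: subspace_scale)
        then have "(x \<bullet> T x) / (norm x)\<^sup>2 \<le> v \<bullet> T v"
          by (simp add: linear_cmul[OF T] power2_eq_square field_simps)
        then show ?thesis
          using False by (simp add: divide_le_eq dot_square_norm)
      qed (simp add: linear_0[OF T])
    qed (use v in \<open>simp_all add: norm_eq_1\<close>)
    then have "P (insert v B)"
      using B v by (auto simp: P_def pairwise_insert orthogonal_def S_def inner_commute[of _ v])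
    moreover have "v \<notin> B"
      using v by (auto simp: S_def norm_eq_1)
    ultimately show False
      using maximal[of "insert v B"] bound[OF B] by simp
  qed
  then have "orthonormal_basis B"
    using B by (auto simp: P_def orthonormal_basis_def)
  moreover obtain \<mu> where "\<And>b. b \<in> B \<Longrightarrow> T b = \<mu> b *\<^sub>R b"
    using B unfolding P_def by metis
  ultimately show ?thesis by (rule that)
qed

section \<open>Hermitian matrices as real self-adjoint operators\<close>

lemma inner_complex_vector: "x \<bullet> y = Re (\<Sum>i\<in>UNIV. cnj (x $ i) * y $ i)"
  for x y :: "complex ^ 'n"
  by (simp add: inner_vec_def inner_complex_def)

lemma Re_hs_inner: "Re (hs_inner X Y) = X \<bullet> Y"
proof -
  have "Re (hs_inner X Y) = (\<Sum>i\<in>UNIV. \<Sum>k\<in>UNIV. X $ k $ i \<bullet> Y $ k $ i)"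
    by (simp add: hs_inner_def trace_def conj_transpose_def matrix_matrix_mult_def inner_complex_def)
  then show ?thesis
    by (subst (asm) sum.swap) (simp add: inner_vec_def)
qed

lemma Re_trace: "Re (trace X) = mat 1 \<bullet> X"
proof -
  have "hs_inner (mat 1) X = trace X"
    by (simp add: hs_inner_def trace_def conj_transpose_def matrix_matrix_mult_def mat_def
        if_distrib[of cnj] if_distrib[of "\<lambda>z. z * _"] cong: if_cong)
  then show ?thesis
    by (metis Re_hs_inner)
qed

lemma inner_matrix_vector: "(A *v x) \<bullet> y = x \<bullet> (conj_transpose A *v y)"
  for A :: "complex ^ 'n ^ 'n"
proof -
  have "(\<Sum>i\<in>UNIV. cnj ((A *v x) $ i) * y $ i)
      = (\<Sum>i\<in>UNIV. \<Sum>j\<in>UNIV. cnj (x $ j) * (cnj (A $ i $ j) * y $ i))"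
    by (simp add: matrix_vector_mult_def sum_distrib_right sum_distrib_left mult_ac)
  also have "\<dots> = (\<Sum>j\<in>UNIV. cnj (x $ j) * (conj_transpose A *v y) $ j)"
    by (subst sum.swap) (simp add: matrix_vector_mult_def conj_transpose_def sum_distrib_left)
  finally show ?thesis
    by (simp only: inner_complex_vector)
qed

lemma hermitian_iff_selfadjoint:
  "hermitian A \<longleftrightarrow> (\<forall>x y. (A *v x) \<bullet> y = x \<bullet> (A *v y))"
proof
  assume "\<forall>x y. (A *v x) \<bullet> y = x \<bullet> (A *v y)"
  then have "x \<bullet> (conj_transpose A *v y) = x \<bullet> (A *v y)" for x y
    by (metis inner_matrix_vector)
  then have "conj_transpose A *v y = A *v y" for y
    by (metis vector_eq_ldot)
  then show "hermitian A"
    by (simp add: hermitian_def matrix_eq)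
qed (simp add: hermitian_def inner_matrix_vector)

lemma scaleR_matrix_vector: "(c *\<^sub>R A) *v x = c *\<^sub>R (A *v x)"
  for A :: "complex ^ 'n ^ 'm"
  by (simp add: vec_eq_iff matrix_vector_mult_def scaleR_sum_right)

lemma scaleC_matrix_vector: "A *v (c *s x) = c *s (A *v x)"
  for A :: "complex ^ 'n ^ 'm"
  by (simp add: vec_eq_iff matrix_vector_mult_def sum_distrib_left mult_ac)

text \<open>The factor \<open>2\<close> appears because the sum is the trace of an operator on the underlying real space, whose
dimension is twice the complex one: each column is met along \<open>1\<close> and along \<open>\<i>\<close>.\<close>

lemma sum_inner_matrix_vector_basis:
  fixes X Y :: "complex ^ 'n ^ 'n"
  assumes "orthonormal_basis B"
  shows "(\<Sum>b\<in>B. (X *v b) \<bullet> (Y *v b)) = 2 * (X \<bullet> Y)"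
proof -
  have col: "(Z *v axis i u) $ k = Z $ k $ i * u" for Z :: "complex ^ 'n ^ 'n" and i u k
    by (simp add: matrix_vector_mult_def axis_def if_distrib[of "\<lambda>z. _ * z"] cong: if_cong)
  have inj: "inj_on (\<lambda>(i, u). axis i u :: complex ^ 'n) (UNIV \<times> {1, \<i>})"
    by (auto simp: inj_on_def axis_eq_axis)
  have Basis: "(Basis :: (complex ^ 'n) set) = (\<lambda>(i, u). axis i u) ` (UNIV \<times> {1, \<i>})"
    by (auto simp: Basis_vec_def Basis_complex_def)
  have "(\<Sum>b\<in>B. (X *v b) \<bullet> (Y *v b)) = (\<Sum>b\<in>Basis. (X *v b) \<bullet> (Y *v b))"
    by (intro sum_inner_orthonormal_basis_eq assms orthonormal_basis_Basis) auto
  also have "\<dots> = (\<Sum>i\<in>UNIV. \<Sum>u\<in>{1, \<i>}. (X *v axis i u) \<bullet> (Y *v axis i u))"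
    unfolding Basis sum.cartesian_product
    by (subst sum.reindex[OF inj]) (auto intro!: sum.cong)
  also have "\<dots> = (\<Sum>i\<in>UNIV. \<Sum>k\<in>UNIV. 2 * (X $ k $ i \<bullet> Y $ k $ i))"
    by (simp add: inner_vec_def col inner_complex_def complex_eq_iff sum.distrib[symmetric])
       (simp add: algebra_simps)
  also have "\<dots> = 2 * (X \<bullet> Y)"
    by (subst sum.swap) (simp add: inner_vec_def sum_distrib_left)
  finally show ?thesis .
qed

section \<open>Functional calculus in a real eigenbasis\<close>

text \<open>The eigenvalues are given as a function on the basis vectors, so that a scalar function can be
applied to them by composition. The basis \<open>B\<close> is always orthonormal over the reals and thus has
twice as many elements as the matrix has rows.\<close>

definition diagonal_on :: "(complex ^ 'n) set \<Rightarrow> (complex ^ 'n \<Rightarrow> real) \<Rightarrow> complex ^ 'n ^ 'n \<Rightarrow> bool" where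
  "diagonal_on B x X \<longleftrightarrow> (\<forall>b\<in>B. X *v b = x b *\<^sub>R b)"

lemma diagonal_on_0: "diagonal_on B (\<lambda>_. 0) 0"
  and diagonal_on_mat_1: "diagonal_on B (\<lambda>_. 1) (mat 1)"
  by (simp_all add: diagonal_on_def)

lemma diagonal_on_diff:
  "diagonal_on B x X \<Longrightarrow> diagonal_on B y Y \<Longrightarrow> diagonal_on B (\<lambda>b. x b - y b) (X - Y)"
  by (simp add: diagonal_on_def matrix_vector_mult_diff_rdistrib scaleR_left_diff_distrib)

lemma diagonal_on_scaleR: "diagonal_on B x X \<Longrightarrow> diagonal_on B (\<lambda>b. c * x b) (c *\<^sub>R X)"
  by (simp add: diagonal_on_def scaleR_matrix_vector)

lemma diagonal_on_uminus: "diagonal_on B x X \<Longrightarrow> diagonal_on B (\<lambda>b. - x b) (- X)"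
  using diagonal_on_diff[OF diagonal_on_0] by fastforce

lemma diagonal_on_unique:
  assumes "orthonormal_basis B" "diagonal_on B x X" "diagonal_on B x Y"
  shows "X = Y"
  unfolding matrix_eq
  using linear_eq_on_orthonormal_basis[OF assms(1), of "(*v) X" "(*v) Y"] assms(2,3)
  by (auto simp: diagonal_on_def)

lemma diagonal_on_hermitian:
  assumes B: "orthonormal_basis B" and X: "diagonal_on B x X"
  shows "hermitian X"
proof -
  have "X *v y = (\<Sum>b\<in>B. ((y \<bullet> b) * x b) *\<^sub>R b)" for y
  proof (rule linear_eq_on_orthonormal_basis[OF B, where F = "(*v) X"])
    show "linear (\<lambda>y. \<Sum>b\<in>B. ((y \<bullet> b) * x b) *\<^sub>R b)"
      by (intro linearI)
         (auto simp: inner_add_left scaleR_add_left sum.distrib scaleR_sum_right algebra_simps)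
    fix c assume c: "c \<in> B"
    then show "X *v c = (\<Sum>b\<in>B. ((c \<bullet> b) * x b) *\<^sub>R b)"
      using X orthonormal_basis_finite[OF B]
      by (simp add: orthonormal_basis_inner[OF B] diagonal_on_def if_distrib[of "\<lambda>t. (t * _) *\<^sub>R _"]
           cong: if_cong)
  qed simp
  then show ?thesis
    by (simp add: hermitian_iff_selfadjoint inner_sum_left inner_sum_right inner_commute mult_ac)
qed

lemma hermitian_diagonalizable:
  assumes "hermitian A"
  obtains B x where "orthonormal_basis B" "diagonal_on B x A"
  using selfadjoint_orthonormal_eigenbasis[of "(*v) A"] assms
  unfolding hermitian_iff_selfadjoint diagonal_on_def
  by (metis matrix_vector_mul_linear)

text \<open>The device that turns inequalities between scalars into inequalities between non-commuting
matrices. The vector \<open>(X - Y) b\<close> has the coordinate \<open>(x b - y c) (b \<bullet> c)\<close> along \<open>c\<close>, because \<open>X\<close> may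
be evaluated at \<open>b\<close> and the self-adjoint \<open>Y\<close> at \<open>c\<close>. The matrices \<open>X1\<close> and \<open>X2\<close> share the
eigenbasis \<open>B\<close>, as \<open>Y1\<close> and \<open>Y2\<close> share \<open>C\<close>; typical choices are a matrix and its exponential.\<close>

lemma inner_diff_diagonal_on:
  assumes B: "orthonormal_basis B" and C: "orthonormal_basis C"
    and X: "diagonal_on B x1 X1" "diagonal_on B x2 X2"
    and Y: "diagonal_on C y1 Y1" "diagonal_on C y2 Y2"
  shows "2 * ((X1 - Y1) \<bullet> (X2 - Y2))
       = (\<Sum>b\<in>B. \<Sum>c\<in>C. (b \<bullet> c)\<^sup>2 * ((x1 b - y1 c) * (x2 b - y2 c)))"
proof -
  have coord: "((X - Y) *v b) \<bullet> c = (b \<bullet> c) * (x b - y c)"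
    if "diagonal_on B x X" "diagonal_on C y Y" "b \<in> B" "c \<in> C" for x X y Y b c
    using that diagonal_on_hermitian[OF C that(2)]
    by (simp add: matrix_vector_mult_diff_rdistrib inner_diff_left hermitian_iff_selfadjoint
        diagonal_on_def algebra_simps)
  have "2 * ((X1 - Y1) \<bullet> (X2 - Y2)) = (\<Sum>b\<in>B. ((X1 - Y1) *v b) \<bullet> ((X2 - Y2) *v b))"
    by (simp add: sum_inner_matrix_vector_basis[OF B])
  also have "\<dots> = (\<Sum>b\<in>B. \<Sum>c\<in>C. (((X1 - Y1) *v b) \<bullet> c) * (((X2 - Y2) *v b) \<bullet> c))"
    by (intro sum.cong refl inner_orthonormal_basis[OF C])
  also have "\<dots> = (\<Sum>b\<in>B. \<Sum>c\<in>C. (b \<bullet> c)\<^sup>2 * ((x1 b - y1 c) * (x2 b - y2 c)))"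
    using X Y by (intro sum.cong refl) (simp add: coord[OF X(1) Y(1)] coord[OF X(2) Y(2)] power2_eq_square mult_ac)
  finally show ?thesis .
qed

text \<open>The operator acting as \<open>h (x b)\<close> on each \<open>b\<close> is only real-linear by construction. It multiplies every
eigenvector of \<open>A\<close> for the eigenvalue \<open>m\<close> by \<open>h m\<close>, and multiplying an eigenvector by a complex scalar
yields an eigenvector for the same eigenvalue; hence it is complex-linear and given by a matrix.\<close>

lemma functional_calculus:
  assumes B: "orthonormal_basis B" and A: "diagonal_on B x A"
  obtains H where "diagonal_on B (\<lambda>b. h (x b)) H"
proof -
  define F where "F y = (\<Sum>b\<in>B. ((y \<bullet> b) * h (x b)) *\<^sub>R b)" for y
  have linear: "linear F"
    unfolding F_def
    by (intro linearI)
       (auto simp: inner_add_left scaleR_add_left sum.distrib scaleR_sum_right algebra_simps)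
  have eigen: "F y = h m *\<^sub>R y" if "A *v y = m *\<^sub>R y" for m y
  proof -
    have "(y \<bullet> b) * h (x b) = h m * (y \<bullet> b)" if "b \<in> B" for b
    proof -
      have "m * (y \<bullet> b) = (A *v y) \<bullet> b"
        by (simp add: \<open>A *v y = m *\<^sub>R y\<close>)
      also have "\<dots> = x b * (y \<bullet> b)"
        using diagonal_on_hermitian[OF B A] A \<open>b \<in> B\<close>
        by (simp add: hermitian_iff_selfadjoint diagonal_on_def)
      finally show ?thesis by auto
    qed
    then have "F y = (\<Sum>b\<in>B. h m *\<^sub>R ((y \<bullet> b) *\<^sub>R b))"
      unfolding F_def by (intro sum.cong refl) simp
    then show ?thesis
      by (simp only: scaleR_sum_right[symmetric] orthonormal_basis_expansion[OF B])
  qed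
  have scaleC: "F (c *s y) = c *s F y" for c y
  proof (rule linear_eq_on_orthonormal_basis[OF B, where F = "\<lambda>y. F (c *s y)"])
    have "linear (\<lambda>y::complex^'a. c *s y)"
      by (intro linearI) (auto simp: vec_eq_iff algebra_simps)
    then show "linear (\<lambda>y. F (c *s y))" "linear (\<lambda>y. c *s F y)"
      using linear linear_compose[unfolded o_def] by blast+
    fix b assume "b \<in> B"
    have swap: "c *s (t *\<^sub>R b) = t *\<^sub>R (c *s b)" for t
      by (simp add: vec_eq_iff)
    have "A *v b = x b *\<^sub>R b"
      using A \<open>b \<in> B\<close> by (simp add: diagonal_on_def)
    then show "F (c *s b) = c *s F b"
      by (simp add: eigen[of b "x b"] eigen[of "c *s b" "x b"] scaleC_matrix_vector swap)
  qed
  have "Vector_Spaces.linear (*s) (*s) F"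
    by unfold_locales (auto simp: scaleC linear_add[OF linear] vec_eq_iff algebra_simps)
  then have "matrix F *v y = F y" for y
    by (rule matrix_works)
  then have "diagonal_on B (\<lambda>b. h (x b)) (matrix F)"
    using A by (simp add: diagonal_on_def eigen)
  then show ?thesis by (rule that)
qed

lemma mat_power_diagonal_on:
  assumes "diagonal_on B x A"
  shows "diagonal_on B (\<lambda>b. x b ^ n) (mat_power A n)"
proof (induction n)
  case (Suc n)
  then show ?case
    using assms
    by (simp add: mat_power_def diagonal_on_def matrix_vector_mul_assoc[symmetric]
        linear_cmul[OF matrix_vector_mul_linear] mult.commute)
qed (simp add: mat_power_def diagonal_on_mat_1)

lemma diagonal_on_sum:
  assumes "\<And>i. i \<in> I \<Longrightarrow> diagonal_on B (x i) (X i)"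
  shows "diagonal_on B (\<lambda>b. \<Sum>i\<in>I. x i b) (\<Sum>i\<in>I. X i)"
  using assms
  by (induction I rule: infinite_finite_induct)
     (auto simp: diagonal_on_def matrix_vector_mult_add_rdistrib scaleR_add_left)

text \<open>On each basis vector the partial sums of the matrix series act by partial sums of the scalar
exponential series, and \<open>sum_inner_matrix_vector_basis\<close> turns convergence on the basis into
convergence in norm.\<close>

lemma mat_exp_diagonal_on:
  assumes B: "orthonormal_basis B" and A: "diagonal_on B x A"
  shows "diagonal_on B (\<lambda>b. exp (x b)) (mat_exp A)"
proof -
  obtain E where E: "diagonal_on B (\<lambda>b. exp (x b)) E"
    using functional_calculus[OF B A] .
  define S where "S N = (\<Sum>n<N. (1 / fact n) *\<^sub>R mat_power A n)" for N
  define s where "s N b = (\<Sum>n<N. (1 / fact n) * x b ^ n)" for N b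
  have S: "diagonal_on B (s N) (S N)" for N
    unfolding S_def s_def
    by (intro diagonal_on_sum diagonal_on_scaleR mat_power_diagonal_on A)
  have "2 * ((S N - E) \<bullet> (S N - E)) = (\<Sum>b\<in>B. (s N b - exp (x b))\<^sup>2)" for N
  proof -
    have "diagonal_on B (\<lambda>b. s N b - exp (x b)) (S N - E)"
      by (intro diagonal_on_diff S E)
    then show ?thesis
      using B by (simp add: sum_inner_matrix_vector_basis[OF B, symmetric] diagonal_on_def
          orthonormal_basis_def norm_eq_1 power2_eq_square)
  qed
  then have norm_eq: "norm (S N - E) = sqrt ((\<Sum>b\<in>B. (s N b - exp (x b))\<^sup>2) / 2)" for N
    by (metis mult.commute nonzero_mult_div_cancel_left norm_eq_sqrt_inner zero_neq_numeral)
  have "(\<lambda>N. s N b) \<longlonglongrightarrow> exp (x b)" for b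
    using exp_converges[of "x b"] by (simp add: sums_def s_def divide_inverse)
  then have "(\<lambda>N. sqrt ((\<Sum>b\<in>B. (s N b - exp (x b))\<^sup>2) / 2))
      \<longlonglongrightarrow> sqrt ((\<Sum>b\<in>B. (exp (x b) - exp (x b))\<^sup>2) / 2)"
    by (intro tendsto_intros) auto
  then have "(\<lambda>N. norm (S N - E)) \<longlonglongrightarrow> 0"
    by (simp add: norm_eq)
  then have "S \<longlonglongrightarrow> E"
    using LIM_zero_iff[of S E] tendsto_norm_zero_iff by blast
  then have "(\<lambda>n. (1 / fact n) *\<^sub>R mat_power A n) sums E"
    by (simp add: sums_def S_def[abs_def])
  then have "mat_exp A = E"
    unfolding mat_exp_def by (rule sums_unique[symmetric])
  with E show ?thesis by simp
qed

section \<open>Inequalities for the matrix exponential\<close>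

lemma mat_exp_hermitian:
  assumes "hermitian A"
  shows "hermitian (mat_exp A)"
  using assms hermitian_diagonalizable mat_exp_diagonal_on diagonal_on_hermitian by metis

lemma trace_diagonal_on:
  assumes B: "orthonormal_basis B" and X: "diagonal_on B x X"
  shows "2 * Re (trace X) = (\<Sum>b\<in>B. x b)"
proof -
  have "2 * Re (trace X) = (\<Sum>b\<in>B. (mat 1 *v b) \<bullet> (X *v b))"
    unfolding Re_trace by (rule sum_inner_matrix_vector_basis[OF B, symmetric])
  also have "\<dots> = (\<Sum>b\<in>B. x b)"
    using B X by (intro sum.cong) (auto simp: diagonal_on_def orthonormal_basis_def norm_eq_1)
  finally show ?thesis .
qed

text \<open>The bound is \<open>2\<close> rather than \<open>1\<close> because the real trace of a matrix with trace \<open>1\<close> is \<open>2\<close>; every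
eigenvalue is counted twice in a real eigenbasis.\<close>

lemma log_eigenvalue_bound:
  assumes B: "orthonormal_basis B" and L: "diagonal_on B l L" and tr: "Re (trace (mat_exp L)) = 1"
    and b: "b \<in> B"
  shows "exp (l b) \<le> 2"
proof -
  have "exp (l b) \<le> (\<Sum>b\<in>B. exp (l b))"
    using b orthonormal_basis_finite[OF B] by (intro member_le_sum) auto
  also have "\<dots> = 2"
    using trace_diagonal_on[OF B mat_exp_diagonal_on[OF B L]] tr by simp
  finally show ?thesis .
qed

text \<open>On a half-line where \<open>exp \<le> C\<close> the exponential is increasing and has Lipschitz constant \<open>C\<close>.\<close>

lemma exp_cocoercive:
  fixes a b :: real
  assumes "exp a \<le> C" "exp b \<le> C"
  shows "(exp a - exp b)\<^sup>2 \<le> C * ((a - b) * (exp a - exp b))"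
  using assms
proof (induction a b rule: linorder_wlog)
  case (le a b)
  have "exp b * (1 + (a - b)) \<le> exp b * exp (a - b)"
    by (intro mult_left_mono exp_ge_add_one_self) simp
  then have "exp b - exp a \<le> exp b * (b - a)"
    by (simp add: exp_diff algebra_simps)
  also have "\<dots> \<le> C * (b - a)"
    using le by (intro mult_right_mono) auto
  finally have "(exp b - exp a) * (exp b - exp a) \<le> C * (b - a) * (exp b - exp a)"
    using le by (intro mult_right_mono) auto
  then show ?case
    by (simp add: power2_eq_square algebra_simps)
next
  case (sym a b)
  then show ?case
    by (simp add: power2_eq_square algebra_simps)
qed

text \<open>This plays the role of Pinsker's inequality: the right-hand side is twice the sum of the two
relative entropies between the density matrices. In the weighted sums of \<open>inner_diff_diagonal_on\<close> it becomes
\<open>exp_cocoercive\<close> for each pair of eigenvalues.\<close>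

lemma mat_exp_cocoercive:
  assumes L: "hermitian L" "Re (trace (mat_exp L)) = 1"
    and M: "hermitian M" "Re (trace (mat_exp M)) = 1"
  shows "(norm (mat_exp L - mat_exp M))\<^sup>2 \<le> 2 * ((L - M) \<bullet> (mat_exp L - mat_exp M))"
proof -
  obtain B l where B: "orthonormal_basis B" and l: "diagonal_on B l L"
    using L(1) by (rule hermitian_diagonalizable)
  obtain C m where C: "orthonormal_basis C" and m: "diagonal_on C m M"
    using M(1) by (rule hermitian_diagonalizable)
  note el = mat_exp_diagonal_on[OF B l] and em = mat_exp_diagonal_on[OF C m]
  have "2 * ((mat_exp L - mat_exp M) \<bullet> (mat_exp L - mat_exp M))
      = (\<Sum>b\<in>B. \<Sum>c\<in>C. (b \<bullet> c)\<^sup>2 * ((exp (l b) - exp (m c)) * (exp (l b) - exp (m c))))"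
    by (rule inner_diff_diagonal_on[OF B C el el em em])
  also have "\<dots> \<le> (\<Sum>b\<in>B. \<Sum>c\<in>C. (b \<bullet> c)\<^sup>2 * (2 * ((l b - m c) * (exp (l b) - exp (m c)))))"
    using log_eigenvalue_bound[OF B l L(2)] log_eigenvalue_bound[OF C m M(2)]
    by (intro sum_mono mult_left_mono) (auto simp: exp_cocoercive simp flip: power2_eq_square)
  also have "\<dots> = 2 * (\<Sum>b\<in>B. \<Sum>c\<in>C. (b \<bullet> c)\<^sup>2 * ((l b - m c) * (exp (l b) - exp (m c))))"
    by (simp add: sum_distrib_left mult_ac)
  also have "\<dots> = 2 * (2 * ((L - M) \<bullet> (mat_exp L - mat_exp M)))"
    by (simp only: inner_diff_diagonal_on[OF B C l el m em])
  finally show ?thesis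
    by (simp add: power2_norm_eq_inner)
qed

text \<open>Klein's inequality for the exponential, or convexity of \<open>A \<mapsto> Tr (exp A)\<close>: for each pair
of eigenvalues it is the tangent line inequality of \<open>exp\<close> at \<open>m c\<close>. Zero matrices and the identity,
which are diagonal in any basis, bring each side into the form required by
\<open>inner_diff_diagonal_on\<close>.\<close>

lemma trace_exp_gradient_inequality:
  assumes "hermitian L" "hermitian M"
  shows "mat_exp M \<bullet> (L - M) \<le> Re (trace (mat_exp L)) - Re (trace (mat_exp M))"
proof -
  obtain B l where B: "orthonormal_basis B" and l: "diagonal_on B l L"
    using assms(1) by (rule hermitian_diagonalizable)
  obtain C m where C: "orthonormal_basis C" and m: "diagonal_on C m M"
    using assms(2) by (rule hermitian_diagonalizable)
  note el = mat_exp_diagonal_on[OF B l] and em = mat_exp_diagonal_on[OF C m]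
  have "2 * (mat_exp M \<bullet> (L - M)) = 2 * ((0 - - mat_exp M) \<bullet> (L - M))"
    by simp
  also have "\<dots> = (\<Sum>b\<in>B. \<Sum>c\<in>C. (b \<bullet> c)\<^sup>2 * ((0 - - exp (m c)) * (l b - m c)))"
    by (rule inner_diff_diagonal_on[OF B C diagonal_on_0 l diagonal_on_uminus[OF em] m])
  also have "\<dots> \<le> (\<Sum>b\<in>B. \<Sum>c\<in>C. (b \<bullet> c)\<^sup>2 * ((exp (l b) - exp (m c)) * (1 - 0)))"
  proof (intro sum_mono mult_left_mono)
    fix b c
    have "exp (m c) * (1 + (l b - m c)) \<le> exp (m c) * exp (l b - m c)"
      by (intro mult_left_mono exp_ge_add_one_self) simp
    then show "(0 - - exp (m c)) * (l b - m c) \<le> (exp (l b) - exp (m c)) * (1 - 0)"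
      by (simp add: exp_diff algebra_simps)
  qed simp
  also have "\<dots> = 2 * ((mat_exp L - mat_exp M) \<bullet> (mat 1 - 0))"
    by (rule inner_diff_diagonal_on[OF B C el diagonal_on_mat_1 em diagonal_on_0, symmetric])
  finally show ?thesis
    by (simp add: Re_trace inner_diff_left inner_diff_right inner_commute[of "mat 1"])
qed

text \<open>If the exponentials agree, then two eigenvectors with \<open>b \<bullet> c \<noteq> 0\<close> belong to equal eigenvalues of
the exponentials, hence of the matrices themselves.\<close>

lemma mat_exp_injective:
  assumes "hermitian L" "hermitian M" and eq: "mat_exp L = mat_exp M"
  shows "L = M"
proof -
  obtain B l where B: "orthonormal_basis B" and l: "diagonal_on B l L"
    using assms(1) by (rule hermitian_diagonalizable)
  obtain C m where C: "orthonormal_basis C" and m: "diagonal_on C m M"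
    using assms(2) by (rule hermitian_diagonalizable)
  note el = mat_exp_diagonal_on[OF B l] and em = mat_exp_diagonal_on[OF C m]
  have "(\<Sum>b\<in>B. \<Sum>c\<in>C. (b \<bullet> c)\<^sup>2 * ((exp (l b) - exp (m c)) * (exp (l b) - exp (m c)))) = 0"
    using inner_diff_diagonal_on[OF B C el el em em] by (simp add: eq)
  then have "(b \<bullet> c)\<^sup>2 * ((exp (l b) - exp (m c)) * (exp (l b) - exp (m c))) = 0"
    if "b \<in> B" "c \<in> C" for b c
    using that orthonormal_basis_finite[OF B] orthonormal_basis_finite[OF C]
    by (simp add: sum_nonneg_eq_0_iff sum_nonneg)
  then have "(b \<bullet> c)\<^sup>2 * ((l b - m c) * (l b - m c)) = 0" if "b \<in> B" "c \<in> C" for b c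
    using that by force
  then have "(\<Sum>b\<in>B. \<Sum>c\<in>C. (b \<bullet> c)\<^sup>2 * ((l b - m c) * (l b - m c))) = 0"
    by (intro sum.neutral ballI)
  then show ?thesis
    using inner_diff_diagonal_on[OF B C l l m m] by simp
qed

lemma mat_log_mat_exp: "hermitian L \<Longrightarrow> mat_log (mat_exp L) = L"
  unfolding mat_log_def by (rule the_equality) (auto intro: mat_exp_injective)

section \<open>Density matrices and their logarithms\<close>

lemma hermitian_diff: "hermitian A \<Longrightarrow> hermitian B \<Longrightarrow> hermitian (A - B)"
  and hermitian_scaleR: "hermitian A \<Longrightarrow> hermitian (c *\<^sub>R A)"
  and hermitian_mat_1: "hermitian (mat 1)"
  by (auto simp: hermitian_def conj_transpose_def vec_eq_iff mat_def)

lemma hermitian_trace_real: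
  assumes "hermitian A"
  shows "trace A = of_real (Re (trace A))"
proof -
  have "Im (A $ i $ i) = 0" for i
  proof -
    have "cnj (A $ i $ i) = A $ i $ i"
      using assms by (simp add: hermitian_def conj_transpose_def vec_eq_iff)
    then show ?thesis
      by (simp add: complex_eq_iff)
  qed
  then show ?thesis
    by (simp add: complex_eq_iff trace_def)
qed

lemma pos_semidef_iff: "pos_semidef A \<longleftrightarrow> hermitian A \<and> (\<forall>v. 0 \<le> v \<bullet> (A *v v))"
  by (simp add: pos_semidef_def inner_complex_vector)

lemma pos_semidef_diagonal_on:
  assumes "pos_semidef A" "orthonormal_basis B" "diagonal_on B x A" "b \<in> B"
  shows "0 \<le> x b"
proof -
  have "0 \<le> b \<bullet> (A *v b)"
    using assms(1) by (simp add: pos_semidef_iff)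
  then show ?thesis
    using assms(2-4) by (simp add: diagonal_on_def orthonormal_basis_def norm_eq_1)
qed

lemma mat_exp_nonsingular_density:
  assumes L: "hermitian L" and tr: "Re (trace (mat_exp L)) = 1"
  shows "mat_exp L \<in> nonsingular_density_matrices"
proof -
  obtain B l where B: "orthonormal_basis B" and l: "diagonal_on B l L"
    using L by (rule hermitian_diagonalizable)
  note el = mat_exp_diagonal_on[OF B l] and herm = mat_exp_hermitian[OF L]
  have "0 \<le> v \<bullet> (mat_exp L *v v)" for v
  proof -
    have "v \<bullet> (mat_exp L *v v) = (\<Sum>b\<in>B. (v \<bullet> b) * (v \<bullet> (mat_exp L *v b)))"
      using herm by (subst inner_orthonormal_basis[OF B]) (simp add: hermitian_iff_selfadjoint)
    also have "\<dots> = (\<Sum>b\<in>B. exp (l b) * (v \<bullet> b)\<^sup>2)"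
      using el by (intro sum.cong) (auto simp: diagonal_on_def power2_eq_square)
    finally show ?thesis
      by (simp add: sum_nonneg)
  qed
  then have "pos_semidef (mat_exp L)"
    using herm by (simp add: pos_semidef_iff)
  moreover have "trace (mat_exp L) = 1"
    using hermitian_trace_real[OF herm] tr by simp
  moreover have "invertible (mat_exp L)"
  proof -
    obtain H where H: "diagonal_on B (\<lambda>b. exp (- l b)) H"
      using functional_calculus[OF B l, of "\<lambda>t. exp (- t)"] .
    have "diagonal_on B (\<lambda>_. 1) (H ** mat_exp L)"
      using el H by (simp add: diagonal_on_def matrix_vector_mul_assoc[symmetric]
          linear_cmul[OF matrix_vector_mul_linear] exp_minus)
    then show ?thesis
      using diagonal_on_unique[OF B _ diagonal_on_mat_1] invertible_left_inverse by blast
  qed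
  ultimately show ?thesis
    by (simp add: nonsingular_density_matrices_def density_matrices_def)
qed

lemma nonsingular_density_obtain_log:
  assumes "\<rho> \<in> nonsingular_density_matrices"
  obtains L where "hermitian L" "\<rho> = mat_exp L" "mat_log \<rho> = L"
proof -
  have psd: "pos_semidef \<rho>" and inv: "invertible \<rho>"
    using assms by (auto simp: nonsingular_density_matrices_def density_matrices_def)
  obtain B x where B: "orthonormal_basis B" and x: "diagonal_on B x \<rho>"
    using psd hermitian_diagonalizable unfolding pos_semidef_iff by metis
  have pos: "0 < x b" if "b \<in> B" for b
  proof -
    have "x b \<noteq> 0"
    proof
      assume "x b = 0"
      then have "\<rho> *v b = 0"
        using x that by (simp add: diagonal_on_def)
      then have "b = 0"
        using inv by (metis invertible_def matrix_vector_mul_assoc matrix_vector_mul_lid matrix_vector_mult_0_right)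
      with B that show False
        by (force simp: orthonormal_basis_def)
    qed
    with pos_semidef_diagonal_on[OF psd B x that] show ?thesis by simp
  qed
  obtain L where L: "diagonal_on B (\<lambda>b. ln (x b)) L"
    using functional_calculus[OF B x] .
  have "diagonal_on B x (mat_exp L)"
    using mat_exp_diagonal_on[OF B L] pos by (simp add: diagonal_on_def)
  then have "\<rho> = mat_exp L"
    by (rule diagonal_on_unique[OF B x])
  moreover have "hermitian L"
    by (rule diagonal_on_hermitian[OF B L])
  ultimately show ?thesis
    using that mat_log_mat_exp by blast
qed

lemma mat_exp_shift:
  assumes "hermitian A"
  shows "mat_exp (A - t *\<^sub>R mat 1) = exp (- t) *\<^sub>R mat_exp A"
proof -
  obtain B x where B: "orthonormal_basis B" and x: "diagonal_on B x A"
    using assms by (rule hermitian_diagonalizable)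
  have "diagonal_on B (\<lambda>b. x b - t * 1) (A - t *\<^sub>R mat 1)"
    by (intro diagonal_on_diff diagonal_on_scaleR diagonal_on_mat_1 x)
  from mat_exp_diagonal_on[OF B this]
  have "diagonal_on B (\<lambda>b. exp (- t) * exp (x b)) (mat_exp (A - t *\<^sub>R mat 1))"
    by (simp add: exp_diff exp_minus field_simps)
  then show ?thesis
    by (rule diagonal_on_unique[OF B]) (intro diagonal_on_scaleR mat_exp_diagonal_on B x)
qed

lemma compact_density_matrices: "compact (density_matrices :: (complex ^ 'n ^ 'n) set)"
proof -
  have "closed (density_matrices :: (complex ^ 'n ^ 'n) set)"
    unfolding density_matrices_def pos_semidef_def hermitian_def conj_transpose_def vec_eq_iff
      vec_lambda_beta trace_def matrix_vector_mult_def
    by (intro closed_Collect_conj closed_Collect_all closed_Collect_eq closed_Collect_le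
        continuous_intros)
  moreover have "norm \<rho> \<le> sqrt 2" if "\<rho> \<in> density_matrices" for \<rho> :: "complex ^ 'n ^ 'n"
  proof -
    have psd: "pos_semidef \<rho>" and tr: "trace \<rho> = 1"
      using that by (auto simp: density_matrices_def)
    obtain B x where B: "orthonormal_basis B" and x: "diagonal_on B x \<rho>"
      using psd hermitian_diagonalizable unfolding pos_semidef_iff by metis
    have sum: "(\<Sum>b\<in>B. x b) = 2"
      using trace_diagonal_on[OF B x] tr by simp
    have nonneg: "0 \<le> x b" if "b \<in> B" for b
      using pos_semidef_diagonal_on[OF psd B x that] .
    have "x b \<le> 2" if "b \<in> B" for b
      using member_le_sum[of b B x] that nonneg orthonormal_basis_finite[OF B] sum by auto
    then have "(\<Sum>b\<in>B. x b * x b) \<le> (\<Sum>b\<in>B. 2 * x b)"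
      using nonneg by (intro sum_mono mult_right_mono) auto
    moreover have "(\<Sum>b\<in>B. x b * x b) = (\<Sum>b\<in>B. (\<rho> *v b) \<bullet> (\<rho> *v b))"
      using B x by (intro sum.cong) (auto simp: diagonal_on_def orthonormal_basis_def norm_eq_1)
    ultimately have "\<rho> \<bullet> \<rho> \<le> 2"
      using sum by (simp add: sum_inner_matrix_vector_basis[OF B] flip: sum_distrib_left)
    then show ?thesis
      by (simp add: norm_eq_sqrt_inner)
  qed
  ultimately show ?thesis
    unfolding compact_eq_bounded_closed bounded_iff by blast
qed

text \<open>All eigenvalues of \<open>log \<rho>\<close> are at most \<open>ln 2\<close> by \<open>log_eigenvalue_bound\<close>. The bound \<open>0\<close> would hold as
well; any bound that does not depend on \<open>\<rho>\<close> keeps the Lyapunov function of the convergence proof from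
decreasing without limit.\<close>

lemma inner_mat_log_upper_bound:
  assumes \<sigma>: "\<sigma> \<in> density_matrices" and \<rho>: "\<rho> \<in> nonsingular_density_matrices"
  shows "\<sigma> \<bullet> mat_log \<rho> \<le> ln 2"
proof -
  obtain L where L: "hermitian L" "\<rho> = mat_exp L" "mat_log \<rho> = L"
    using \<rho> by (rule nonsingular_density_obtain_log)
  have tr: "Re (trace (mat_exp L)) = 1"
    using \<rho> by (simp add: L(2)[symmetric] nonsingular_density_matrices_def density_matrices_def)
  have psd: "pos_semidef \<sigma>" and "trace \<sigma> = 1"
    using \<sigma> by (auto simp: density_matrices_def)
  obtain B s where B: "orthonormal_basis B" and s: "diagonal_on B s \<sigma>"
    using psd hermitian_diagonalizable unfolding pos_semidef_iff by metis
  obtain C l where C: "orthonormal_basis C" and l: "diagonal_on C l L"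
    using L(1) by (rule hermitian_diagonalizable)
  have bound: "l c \<le> ln 2" if "c \<in> C" for c
    using log_eigenvalue_bound[OF C l tr that] by (simp add: ln_ge_iff)
  have "2 * ((\<sigma> - 0) \<bullet> (0 - - L)) = (\<Sum>b\<in>B. \<Sum>c\<in>C. (b \<bullet> c)\<^sup>2 * ((s b - 0) * (0 - - l c)))"
    by (rule inner_diff_diagonal_on[OF B C s diagonal_on_0 diagonal_on_0 diagonal_on_uminus[OF l]])
  also have "\<dots> \<le> (\<Sum>b\<in>B. \<Sum>c\<in>C. (b \<bullet> c)\<^sup>2 * ((s b - 0) * (ln 2 * 1 - 0)))"
    using pos_semidef_diagonal_on[OF psd B s] bound by (intro sum_mono mult_left_mono) auto
  also have "\<dots> = 2 * ((\<sigma> - 0) \<bullet> (ln 2 *\<^sub>R mat 1 - 0))"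
    by (rule inner_diff_diagonal_on[OF B C s diagonal_on_scaleR[OF diagonal_on_mat_1]
          diagonal_on_0 diagonal_on_0, symmetric])
  also have "\<dots> = 2 * ln 2"
    using \<open>trace \<sigma> = 1\<close> Re_trace[of \<sigma>] by (simp add: inner_commute)
  finally show ?thesis
    by (simp add: L(3))
qed

section \<open>The exponentiated gradient update\<close>

text \<open>Normalizing the trace multiplies the exponential by a positive scalar, that is, subtracts a multiple
of the identity from the logarithm.\<close>

lemma eg_update_obtain_log:
  assumes \<rho>: "\<rho> \<in> nonsingular_density_matrices" and g: "hermitian (gradient f \<rho>)"
  obtains t where "eg_update f \<rho> a \<in> nonsingular_density_matrices"
    and "mat_log (eg_update f \<rho> a) = mat_log \<rho> - a *\<^sub>R gradient f \<rho> - t *\<^sub>R mat 1"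
proof -
  obtain L where L: "hermitian L" "mat_log \<rho> = L"
    using \<rho> by (rule nonsingular_density_obtain_log)
  define A where "A = L - a *\<^sub>R gradient f \<rho>"
  define Z where "Z = Re (trace (mat_exp A))"
  have A: "hermitian A"
    unfolding A_def by (intro hermitian_diff hermitian_scaleR L g)
  have "Z > 0"
  proof -
    obtain B x where B: "orthonormal_basis B" and x: "diagonal_on B x A"
      using A by (rule hermitian_diagonalizable)
    have "B \<noteq> {}"
    proof
      assume "B = {}"
      then have "(UNIV :: (complex ^ 'a) set) = {0}"
        using B by (simp add: orthonormal_basis_def)
      then show False
        by (metis UNIV_I UNIV_not_singleton)
    qed
    then have "0 < (\<Sum>b\<in>B. exp (x b))"
      using orthonormal_basis_finite[OF B] by (intro sum_pos) auto
    then show ?thesis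
      using trace_diagonal_on[OF B mat_exp_diagonal_on[OF B x]] by (simp add: Z_def)
  qed
  define M where "M = A - ln Z *\<^sub>R mat 1"
  have update: "eg_update f \<rho> a = mat_exp M"
    using \<open>Z > 0\<close> by (simp add: eg_update_def Let_def L(2) M_def mat_exp_shift[OF A] exp_minus
        flip: A_def Z_def)
  have M: "hermitian M"
    unfolding M_def by (intro hermitian_diff hermitian_scaleR hermitian_mat_1 A)
  have "Re (trace (mat_exp M)) = 1"
    using \<open>Z > 0\<close> by (simp add: M_def mat_exp_shift[OF A] Re_trace exp_minus)
      (simp add: Z_def Re_trace)
  then show ?thesis
    using that[of "ln Z"] mat_exp_nonsingular_density[OF M] mat_log_mat_exp[OF M]
    by (simp add: update M_def A_def L(2))
qed

lemma inner_mat_1_nonsingular_density: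
  assumes "\<rho> \<in> nonsingular_density_matrices"
  shows "mat 1 \<bullet> \<rho> = 1"
  using assms Re_trace[of \<rho>] by (simp add: nonsingular_density_matrices_def density_matrices_def)

text \<open>The case of \<open>mat_exp_cocoercive\<close> for the logarithms of \<open>\<rho>\<close> and of its update, which differ by
\<open>a g + t I\<close>; the multiple of the identity is orthogonal to a difference of matrices of trace \<open>1\<close>.\<close>

lemma eg_update_distance:
  assumes \<rho>: "\<rho> \<in> nonsingular_density_matrices" and g: "hermitian (gradient f \<rho>)"
  shows "(norm (eg_update f \<rho> a - \<rho>))\<^sup>2 \<le> 2 * a * (gradient f \<rho> \<bullet> (\<rho> - eg_update f \<rho> a))"
proof -
  obtain t where s: "eg_update f \<rho> a \<in> nonsingular_density_matrices"
    and t: "mat_log (eg_update f \<rho> a) = mat_log \<rho> - a *\<^sub>R gradient f \<rho> - t *\<^sub>R mat 1"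
    using eg_update_obtain_log[OF \<rho> g] .
  obtain L where L: "hermitian L" "\<rho> = mat_exp L" "mat_log \<rho> = L"
    using \<rho> by (rule nonsingular_density_obtain_log)
  obtain M where M: "hermitian M" "eg_update f \<rho> a = mat_exp M" "mat_log (eg_update f \<rho> a) = M"
    using s by (rule nonsingular_density_obtain_log)
  have tr: "mat 1 \<bullet> mat_exp L = 1" "mat 1 \<bullet> mat_exp M = 1"
    using inner_mat_1_nonsingular_density[OF \<rho>] inner_mat_1_nonsingular_density[OF s]
    by (simp_all flip: L(2) M(2))
  have diff: "L - M = a *\<^sub>R gradient f \<rho> + t *\<^sub>R mat 1"
    using t by (simp add: L(3) M(3))
  have "(norm (mat_exp L - mat_exp M))\<^sup>2 \<le> 2 * ((L - M) \<bullet> (mat_exp L - mat_exp M))"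
    using tr by (intro mat_exp_cocoercive L M) (simp_all add: Re_trace)
  also have "\<dots> = 2 * a * (gradient f \<rho> \<bullet> (mat_exp L - mat_exp M))"
    using tr by (simp add: diff inner_add_left inner_diff_right algebra_simps)
  finally show ?thesis
    by (simp add: L(2)[symmetric] M(2)[symmetric] norm_minus_commute)
qed

lemma eg_update_descent_nonneg:
  assumes "\<rho> \<in> nonsingular_density_matrices" "hermitian (gradient f \<rho>)" "a > 0"
  shows "0 \<le> gradient f \<rho> \<bullet> (\<rho> - eg_update f \<rho> a)"
  using eg_update_distance[OF assms(1,2), of a] assms(3)
    zero_le_power2[of "norm (eg_update f \<rho> a - \<rho>)"]
  by (smt (verit) mult_pos_neg)

text \<open>The three-point inequality of mirror descent, with \<open>- (\<sigma> \<bullet> log \<rho>)\<close> in place of the relative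
entropy of \<open>\<sigma>\<close> and \<open>\<rho>\<close>; the two differ by a constant depending on \<open>\<sigma>\<close> only. Pairing the
new logarithm with \<open>\<sigma>\<close> produces \<open>a (\<sigma> \<bullet> g) + t\<close>, and \<open>trace_exp_gradient_inequality\<close> at two matrices
whose exponentials have the same trace bounds \<open>t\<close> by \<open>- a (\<rho>(a) \<bullet> g)\<close>.\<close>

lemma eg_update_mirror_inequality:
  assumes \<rho>: "\<rho> \<in> nonsingular_density_matrices" and g: "hermitian (gradient f \<rho>)"
    and \<sigma>: "\<sigma> \<in> density_matrices"
  shows "- (\<sigma> \<bullet> mat_log (eg_update f \<rho> a))
       \<le> - (\<sigma> \<bullet> mat_log \<rho>) + a * (gradient f \<rho> \<bullet> (\<sigma> - eg_update f \<rho> a))"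
proof -
  obtain t where s: "eg_update f \<rho> a \<in> nonsingular_density_matrices"
    and t: "mat_log (eg_update f \<rho> a) = mat_log \<rho> - a *\<^sub>R gradient f \<rho> - t *\<^sub>R mat 1"
    using eg_update_obtain_log[OF \<rho> g] .
  obtain L where L: "hermitian L" "\<rho> = mat_exp L" "mat_log \<rho> = L"
    using \<rho> by (rule nonsingular_density_obtain_log)
  obtain M where M: "hermitian M" "eg_update f \<rho> a = mat_exp M" "mat_log (eg_update f \<rho> a) = M"
    using s by (rule nonsingular_density_obtain_log)
  have tr: "mat 1 \<bullet> mat_exp L = 1" "mat 1 \<bullet> mat_exp M = 1"
    using inner_mat_1_nonsingular_density[OF \<rho>] inner_mat_1_nonsingular_density[OF s]
    by (simp_all flip: L(2) M(2))
  have "mat_exp M \<bullet> (L - M) \<le> 0"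
    using trace_exp_gradient_inequality[OF L(1) M(1)] tr by (simp add: Re_trace)
  moreover have "L - M = a *\<^sub>R gradient f \<rho> + t *\<^sub>R mat 1"
    using t by (simp add: L(3) M(3))
  ultimately have "a * (eg_update f \<rho> a \<bullet> gradient f \<rho>) + t \<le> 0"
    using tr by (simp add: inner_add_right M(2) inner_commute[of _ "mat 1"])
  moreover have "\<sigma> \<bullet> mat 1 = 1"
    using \<sigma> Re_trace[of \<sigma>] by (simp add: density_matrices_def inner_commute)
  ultimately show ?thesis
    by (simp add: t inner_diff_right inner_diff_left inner_commute algebra_simps)
qed

section \<open>Armijo condition and line search\<close>

lemma edom_real:
  assumes "convex_ereal f" "x \<in> edom f"
  shows "f x = ereal (real_of_ereal (f x))"
  using assms by (cases "f x") (auto simp: convex_ereal_def edom_def)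

lemma gradient_is_gradient:
  assumes "continuously_differentiable f" "x \<in> edom f"
  shows "is_gradient f x (gradient f x)"
  using assms unfolding gradient_def continuously_differentiable_def by (blast intro: theI')

lemma gradient_inequality:
  assumes "convex_ereal f" "continuously_differentiable f" "x \<in> edom f" "y \<in> edom f"
  shows "real_of_ereal (f x) + gradient f x \<bullet> (y - x) \<le> real_of_ereal (f y)"
proof -
  have "f x + ereal (gradient f x \<bullet> (y - x)) \<le> f y"
    using gradient_is_gradient[OF assms(2,3)] assms(4) by (simp add: is_gradient_def Re_hs_inner)
  then show ?thesis
    by (subst (asm) (1 2) edom_real[OF assms(1)]) (use assms in auto)
qed

definition armijo_condition ::
  "(complex ^ 'n ^ 'n \<Rightarrow> ereal) \<Rightarrow> real \<Rightarrow> complex ^ 'n ^ 'n \<Rightarrow> real \<Rightarrow> bool" where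
  "armijo_condition f \<tau> \<rho> a \<longleftrightarrow>
     f (eg_update f \<rho> a) \<le> f \<rho> + ereal (\<tau> * (gradient f \<rho> \<bullet> (eg_update f \<rho> a - \<rho>)))"

text \<open>Convexity replaces a Taylor expansion: the gradient inequality at the new point bounds
\<open>f s - f \<rho>\<close> by \<open>gradient f s \<bullet> (s - \<rho>)\<close>, and exchanging the gradient at \<open>s\<close> for the one at \<open>\<rho>\<close> costs
at most \<open>K \<parallel>s - \<rho>\<parallel>\<^sup>2\<close>. By \<open>eg_update_distance\<close> this is a small multiple of the predicted decrease.
The point \<open>x\<close> may be singular, as it will be a point of the sublevel set.\<close>

lemma armijo_condition_locally:
  assumes cvx: "convex_ereal f" and cd: "continuously_differentiable f"
    and lip: "locally_lipschitz_gradient f" and dom: "nonsingular_density_matrices \<subseteq> edom f"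
    and "\<tau> < 1" and x: "x \<in> edom f"
  obtains U a\<^sub>0 where "open U" "x \<in> U" "a\<^sub>0 > 0"
    and "\<And>\<rho> a. \<rho> \<in> U \<Longrightarrow> \<rho> \<in> nonsingular_density_matrices \<Longrightarrow> 0 < a \<Longrightarrow> a \<le> a\<^sub>0 \<Longrightarrow>
           armijo_condition f \<tau> \<rho> a"
proof -
  obtain V K where V: "open V" "x \<in> V" and K: "K-lipschitz_on (V \<inter> edom f) (gradient f)"
    using lip x unfolding locally_lipschitz_gradient_def by blast
  obtain e where e: "e > 0" "ball x e \<subseteq> V"
    using V open_contains_ball by blast
  have "K \<ge> 0"
    using K by (rule lipschitz_on_nonneg)
  define G where "G = norm (gradient f x) + K * e"
  have "G \<ge> 0"
    using \<open>K \<ge> 0\<close> e by (simp add: G_def)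
  \<comment> \<open>The first bound keeps the update within distance \<open>e\<close> of \<open>x\<close>, where the Lipschitz estimate holds;
    the second one yields \<open>2 * K * a \<le> 1 - \<tau>\<close>. Here \<open>G\<close> bounds the gradient on \<open>ball x e\<close>, and
    adding \<open>1\<close> excludes division by zero.\<close>
  define a\<^sub>0 where "a\<^sub>0 = min (e / (4 * (G + 1))) ((1 - \<tau>) / (2 * K + 1))"
  have "a\<^sub>0 > 0"
    using \<open>G \<ge> 0\<close> \<open>K \<ge> 0\<close> e \<open>\<tau> < 1\<close> by (simp add: a\<^sub>0_def)
  show ?thesis
  proof (rule that[of "ball x (e / 2)" a\<^sub>0])
    fix \<rho> a assume \<rho>: "\<rho> \<in> ball x (e / 2)" "\<rho> \<in> nonsingular_density_matrices"
      and a: "0 < a" "a \<le> a\<^sub>0"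
    define s where "s = eg_update f \<rho> a"
    define g where "g = gradient f \<rho>"
    define \<Delta> where "\<Delta> = g \<bullet> (\<rho> - s)"
    have \<rho>dom: "\<rho> \<in> edom f" and \<rho>V: "\<rho> \<in> ball x e"
      using \<rho> dom e by auto
    have herm: "hermitian (gradient f \<rho>)"
      using gradient_is_gradient[OF cd \<rho>dom] by (simp add: is_gradient_def)
    have sdom: "s \<in> edom f"
      using eg_update_obtain_log[OF \<rho>(2) herm] dom unfolding s_def by blast
    have dist: "(norm (s - \<rho>))\<^sup>2 \<le> 2 * a * \<Delta>"
      using eg_update_distance[OF \<rho>(2) herm, of a] by (simp add: s_def g_def \<Delta>_def)
    have "\<Delta> \<ge> 0"
      using eg_update_descent_nonneg[OF \<rho>(2) herm a(1)] by (simp add: s_def g_def \<Delta>_def)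
    have "norm g \<le> G"
    proof -
      have "dist g (gradient f x) \<le> K * dist \<rho> x"
        unfolding g_def using lipschitz_onD[OF K] \<rho>V \<rho>dom e V x by blast
      also have "\<dots> \<le> K * e"
        using \<rho>V \<open>K \<ge> 0\<close> by (intro mult_left_mono) (auto simp: dist_commute)
      finally show ?thesis
        using norm_triangle_sub[of g "gradient f x"] by (simp add: G_def dist_norm)
    qed
    \<comment> \<open>The Cauchy-Schwarz inequality bounds \<open>\<Delta>\<close> by \<open>G * norm (s - \<rho>)\<close>, so one factor cancels.\<close>
    have near: "norm (s - \<rho>) \<le> 2 * a * G"
    proof (cases "s = \<rho>")
      case False
      have "norm (s - \<rho>) * norm (s - \<rho>) \<le> 2 * a * (norm g * norm (\<rho> - s))"
        using dist norm_cauchy_schwarz[of g "\<rho> - s"] a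
        by (simp add: \<Delta>_def power2_eq_square) (smt (verit) mult_left_mono)
      also have "\<dots> \<le> 2 * a * (G * norm (\<rho> - s))"
        using \<open>norm g \<le> G\<close> a by (intro mult_left_mono mult_right_mono) auto
      finally show ?thesis
        using False by (simp add: norm_minus_commute)
    qed (use \<open>G \<ge> 0\<close> a in simp)
    have "2 * a * G < e / 2"
    proof -
      have "a * (4 * (G + 1)) \<le> e"
        using a \<open>G \<ge> 0\<close> by (simp add: a\<^sub>0_def pos_le_divide_eq)
      with a(1) show ?thesis
        by (simp add: algebra_simps)
    qed
    with near \<rho> have "s \<in> ball x e"
      using dist_triangle[of x s \<rho>] by (simp add: dist_norm norm_minus_commute)
    then have lipschitz: "norm (gradient f s - g) \<le> K * norm (s - \<rho>)"
      unfolding g_def using lipschitz_onD[OF K, of s \<rho>] subsetD[OF e(2)] \<rho>V \<rho>dom sdom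
      by (simp add: dist_norm)
    have "2 * K * a \<le> 1 - \<tau>"
    proof -
      have "a * (2 * K + 1) \<le> 1 - \<tau>"
        using a \<open>K \<ge> 0\<close> by (simp add: a\<^sub>0_def pos_le_divide_eq)
      with a(1) show ?thesis
        by (simp add: algebra_simps)
    qed
    have "real_of_ereal (f s) \<le> real_of_ereal (f \<rho>) + gradient f s \<bullet> (s - \<rho>)"
      using gradient_inequality[OF cvx cd sdom \<rho>dom] by (simp add: inner_diff_right)
    also have "gradient f s \<bullet> (s - \<rho>) = (gradient f s - g) \<bullet> (s - \<rho>) - \<Delta>"
      by (simp add: \<Delta>_def inner_diff_left inner_diff_right)
    also have "(gradient f s - g) \<bullet> (s - \<rho>) \<le> K * norm (s - \<rho>) * norm (s - \<rho>)"
      using norm_cauchy_schwarz[of "gradient f s - g" "s - \<rho>"] lipschitz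
      by (meson mult_right_mono norm_ge_zero order_trans)
    also have "\<dots> \<le> K * (2 * a * \<Delta>)"
      using dist \<open>K \<ge> 0\<close> by (simp add: power2_eq_square mult_left_mono mult.assoc)
    also have "\<dots> \<le> (1 - \<tau>) * \<Delta>"
      using \<open>2 * K * a \<le> 1 - \<tau>\<close> \<open>\<Delta> \<ge> 0\<close> mult_right_mono[of "2 * K * a" "1 - \<tau>" \<Delta>]
      by (simp add: mult_ac)
    finally have "real_of_ereal (f s) \<le> real_of_ereal (f \<rho>) + \<tau> * (g \<bullet> (s - \<rho>))"
      by (simp add: \<Delta>_def inner_diff_right algebra_simps)
    then show "armijo_condition f \<tau> \<rho> a"
      unfolding armijo_condition_def s_def[symmetric] g_def[symmetric]
      by (subst edom_real[OF cvx sdom], subst edom_real[OF cvx \<rho>dom]) simp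
  qed (use e \<open>a\<^sub>0 > 0\<close> in auto)
qed

text \<open>The thresholds of the finitely many neighbourhoods in a subcover have a positive minimum.\<close>

lemma armijo_condition_uniformly:
  assumes cvx: "convex_ereal f" and cd: "continuously_differentiable f"
    and lip: "locally_lipschitz_gradient f" and dom: "nonsingular_density_matrices \<subseteq> edom f"
    and "\<tau> < 1" and S: "compact S" "S \<subseteq> edom f"
  obtains a\<^sub>0 where "a\<^sub>0 > 0"
    and "\<And>\<rho> a. \<rho> \<in> S \<Longrightarrow> \<rho> \<in> nonsingular_density_matrices \<Longrightarrow> 0 < a \<Longrightarrow> a \<le> a\<^sub>0 \<Longrightarrow>
           armijo_condition f \<tau> \<rho> a"
proof -
  have "\<exists>U a\<^sub>0. open U \<and> x \<in> U \<and> a\<^sub>0 > 0 \<and>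
      (\<forall>\<rho>\<in>U \<inter> nonsingular_density_matrices. \<forall>a. 0 < a \<longrightarrow> a \<le> a\<^sub>0 \<longrightarrow> armijo_condition f \<tau> \<rho> a)"
    if "x \<in> S" for x
  proof -
    have "x \<in> edom f"
      using that S(2) by blast
    then obtain U a\<^sub>0 where "open U" "x \<in> U" "a\<^sub>0 > 0"
      and "\<And>\<rho> a. \<rho> \<in> U \<Longrightarrow> \<rho> \<in> nonsingular_density_matrices \<Longrightarrow> 0 < a \<Longrightarrow> a \<le> a\<^sub>0 \<Longrightarrow>
             armijo_condition f \<tau> \<rho> a"
      using armijo_condition_locally[OF cvx cd lip dom \<open>\<tau> < 1\<close>] by blast
    then show ?thesis
      by (intro exI[of _ U] exI[of _ a\<^sub>0]) simp
  qed
  then obtain U b where U: "\<And>x. x \<in> S \<Longrightarrow> open (U x) \<and> x \<in> U x \<and> b x > 0 \<and>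
      (\<forall>\<rho>\<in>U x \<inter> nonsingular_density_matrices. \<forall>a. 0 < a \<longrightarrow> a \<le> b x \<longrightarrow> armijo_condition f \<tau> \<rho> a)"
    by metis
  obtain T where T: "T \<subseteq> S" "finite T" "S \<subseteq> (\<Union>x\<in>T. U x)"
    using compactE_image[OF S(1), of S U] U by blast
  \<comment> \<open>Inserting \<open>1\<close> covers the case of an empty subcover.\<close>
  define a\<^sub>0 where "a\<^sub>0 = Min (insert 1 (b ` T))"
  have "a\<^sub>0 > 0"
    using T U by (auto simp: a\<^sub>0_def)
  moreover have "armijo_condition f \<tau> \<rho> a"
    if "\<rho> \<in> S" "\<rho> \<in> nonsingular_density_matrices" "0 < a" "a \<le> a\<^sub>0" for \<rho> a
  proof -
    obtain x where x: "x \<in> T" "\<rho> \<in> U x"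
      using T(3) \<open>\<rho> \<in> S\<close> by blast
    then have "a\<^sub>0 \<le> b x"
      using T(2) by (auto simp: a\<^sub>0_def intro: Min_le)
    then show ?thesis
      using U[of x] x T(1) that by auto
  qed
  ultimately show ?thesis by (rule that)
qed

text \<open>A trial value is multiplied by \<open>r\<close> only after a rejection, so it exceeded \<open>a\<^sub>0\<close> before; hence the
accepted value is either the initial one or at least \<open>r * a\<^sub>0\<close>.\<close>

lemma backtracking_terminates:
  fixes r \<alpha> a\<^sub>0 :: real
  assumes r: "0 < r" "r < 1" and "\<alpha> > 0" "a\<^sub>0 > 0"
    and accept: "\<And>a. 0 < a \<Longrightarrow> a \<le> a\<^sub>0 \<Longrightarrow> \<not> reject a"
  obtains \<beta> where "while_option reject (\<lambda>a. r * a) \<alpha> = Some \<beta>"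
    and "min \<alpha> (r * a\<^sub>0) \<le> \<beta>" "\<beta> \<le> \<alpha>" "\<not> reject \<beta>"
proof -
  have pow: "((\<lambda>a. r * a) ^^ k) \<alpha> = r ^ k * \<alpha>" for k
    by (induction k) auto
  obtain k where "r ^ k < a\<^sub>0 / \<alpha>"
    using real_arch_pow_inv[of "a\<^sub>0 / \<alpha>" r] assms by auto
  then have "\<not> reject (((\<lambda>a. r * a) ^^ k) \<alpha>)"
    unfolding pow using assms by (intro accept) (auto simp: field_simps)
  then have "while_option reject (\<lambda>a. r * a) \<alpha> \<noteq> None"
    unfolding while_option_def by auto
  then obtain \<beta> where \<beta>: "while_option reject (\<lambda>a. r * a) \<alpha> = Some \<beta>"
    by blast
  have "min \<alpha> (r * a\<^sub>0) \<le> \<beta> \<and> \<beta> \<le> \<alpha>"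
  proof (rule while_option_rule[OF _ \<beta>])
    fix a assume a: "min \<alpha> (r * a\<^sub>0) \<le> a \<and> a \<le> \<alpha>" and "reject a"
    have "0 < min \<alpha> (r * a\<^sub>0)"
      using assms by simp
    then have "0 < a"
      using a by linarith
    then have "a\<^sub>0 \<le> a"
      using accept[of a] \<open>reject a\<close> by linarith
    then have "r * a\<^sub>0 \<le> r * a" "r * a \<le> a"
      using r \<open>0 < a\<close> by auto
    then show "min \<alpha> (r * a\<^sub>0) \<le> r * a \<and> r * a \<le> \<alpha>"
      using a by linarith
  qed simp
  then show ?thesis
    using that[OF \<beta>] while_option_stop[OF \<beta>] by blast
qed

section \<open>Convergence\<close>

lemma seq_limit_point_in_compact:
  fixes X :: "nat \<Rightarrow> 'a::{t2_space, first_countable_topology}"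
  assumes S: "compact S" "\<And>k. X k \<in> S" and l: "seq_limit_point X l"
  shows "l \<in> S"
proof -
  obtain s where s: "(X \<circ> s) \<longlonglongrightarrow> l"
    using l by (auto simp: seq_limit_point_def)
  have "(X \<circ> s) j \<in> S" for j
    using S(2) by simp
  from closed_sequentially[OF compact_imp_closed[OF S(1)] this s] show ?thesis .
qed

theorem theorem1:
  fixes f :: "complex ^ 'n ^ 'n \<Rightarrow> ereal"
    and \<alpha> r \<tau> :: real
    and \<rho>\<^sub>0 :: "complex ^ 'n ^ 'n"
  assumes "convex_ereal f"
    and "continuously_differentiable f"
    and "locally_lipschitz_gradient f"
    and "continuous_on density_matrices f"
    and "nonsingular_density_matrices \<subseteq> edom f"
    and "\<alpha> > 0" and "0 < r" and "r < 1" and "0 < \<tau>" and "\<tau> < 1"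
    and "\<rho>\<^sub>0 \<in> nonsingular_density_matrices"
  defines "\<rho> \<equiv> eg_iterate f \<alpha> r \<tau> \<rho>\<^sub>0"
  shows "(\<forall>k. armijo_search f \<alpha> r \<tau> (\<rho> k) \<noteq> None) \<and>
         (\<forall>k. \<rho> k \<in> density_matrices) \<and>
         (\<forall>k. f (\<rho> (Suc k)) \<le> f (\<rho> k)) \<and>
         (\<exists>l. seq_limit_point \<rho> l) \<and>
         (\<forall>l. seq_limit_point \<rho> l \<longrightarrow> is_arg_min f (\<lambda>\<sigma>. \<sigma> \<in> density_matrices) l)"
proof -
  note cvx = assms(1) and cd = assms(2) and lip = assms(3) and cont = assms(4) and dom = assms(5)
  define F where "F x = real_of_ereal (f x)" for x
  have F: "f x = ereal (F x)" if "x \<in> edom f" for x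
    unfolding F_def by (rule edom_real[OF cvx that])
  have nonsing: "x \<in> density_matrices" if "x \<in> nonsingular_density_matrices"
    for x :: "complex ^ 'n ^ 'n"
    using that by (simp add: nonsingular_density_matrices_def)
  define S where "S = {x \<in> density_matrices. f x \<le> f \<rho>\<^sub>0}"
  have "f \<rho>\<^sub>0 < \<infinity>"
    using assms(11) dom by (auto simp: edom_def)
  then have S_dom: "S \<subseteq> edom f"
    by (auto simp: S_def edom_def density_matrices_def pos_semidef_def)
  have "closed (density_matrices \<inter> f -` {..f \<rho>\<^sub>0})"
    by (intro continuous_closed_preimage cont compact_imp_closed compact_density_matrices closed_atMost)
  then have "compact (density_matrices \<inter> (density_matrices \<inter> f -` {..f \<rho>\<^sub>0}))"
    by (intro compact_Int_closed compact_density_matrices)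
  then have "compact S"
    by (rule back_subst[of compact]) (auto simp: S_def)
  then obtain a\<^sub>0 where "a\<^sub>0 > 0" and armijo:
    "\<And>\<rho> a. \<rho> \<in> S \<Longrightarrow> \<rho> \<in> nonsingular_density_matrices \<Longrightarrow> 0 < a \<Longrightarrow> a \<le> a\<^sub>0 \<Longrightarrow>
      armijo_condition f \<tau> \<rho> a"
    using armijo_condition_uniformly[OF cvx cd lip dom \<open>\<tau> < 1\<close> _ S_dom] by blast
  define \<beta>\<^sub>0 where "\<beta>\<^sub>0 = min \<alpha> (r * a\<^sub>0)"
  have "\<beta>\<^sub>0 > 0"
    using \<open>\<alpha> > 0\<close> \<open>0 < r\<close> \<open>a\<^sub>0 > 0\<close> by (simp add: \<beta>\<^sub>0_def)
  define \<beta> where "\<beta> k = the (armijo_search f \<alpha> r \<tau> (\<rho> k))" for k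
  define g where "g k = gradient f (\<rho> k)" for k
  have \<rho>_Suc: "\<rho> (Suc k) = eg_update f (\<rho> k) (\<beta> k)" for k
    by (simp add: \<rho>_def \<beta>_def)
  have search: "armijo_search f \<alpha> r \<tau> (\<rho> k) \<noteq> None \<and> \<beta>\<^sub>0 \<le> \<beta> k \<and> \<beta> k \<le> \<alpha> \<and>
      armijo_condition f \<tau> (\<rho> k) (\<beta> k)"
    if k: "\<rho> k \<in> S" "\<rho> k \<in> nonsingular_density_matrices" for k
  proof -
    have eq: "armijo_search f \<alpha> r \<tau> (\<rho> k)
        = while_option (\<lambda>a. \<not> armijo_condition f \<tau> (\<rho> k) a) (\<lambda>a. r * a) \<alpha>"
      by (simp add: armijo_search_def armijo_condition_def Re_hs_inner not_le)
    obtain b where "armijo_search f \<alpha> r \<tau> (\<rho> k) = Some b" "\<beta>\<^sub>0 \<le> b" "b \<le> \<alpha>"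
        "armijo_condition f \<tau> (\<rho> k) b"
      unfolding eq \<beta>\<^sub>0_def
      using backtracking_terminates[OF \<open>0 < r\<close> \<open>r < 1\<close> \<open>\<alpha> > 0\<close> \<open>a\<^sub>0 > 0\<close>,
          of "\<lambda>a. \<not> armijo_condition f \<tau> (\<rho> k) a"] armijo[OF k] by blast
    then show ?thesis
      by (simp add: \<beta>_def)
  qed
  have herm: "hermitian (g k)" if "\<rho> k \<in> nonsingular_density_matrices" for k
    using gradient_is_gradient[OF cd, of "\<rho> k"] that dom by (auto simp: is_gradient_def g_def)
  have descent: "0 \<le> g k \<bullet> (\<rho> k - \<rho> (Suc k)) \<and> \<rho> (Suc k) \<in> nonsingular_density_matrices \<and>
      F (\<rho> (Suc k)) \<le> F (\<rho> k) - \<tau> * (g k \<bullet> (\<rho> k - \<rho> (Suc k)))"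
    if k: "\<rho> k \<in> S" "\<rho> k \<in> nonsingular_density_matrices" for k
  proof -
    have pos: "\<beta> k > 0"
      using search[OF k] \<open>\<beta>\<^sub>0 > 0\<close> by linarith
    have new_nonsing: "\<rho> (Suc k) \<in> nonsingular_density_matrices"
      using eg_update_obtain_log[OF k(2) herm[OF k(2), unfolded g_def]] unfolding \<rho>_Suc by blast
    have "f (\<rho> (Suc k)) \<le> f (\<rho> k) + ereal (\<tau> * (g k \<bullet> (\<rho> (Suc k) - \<rho> k)))"
      using search[OF k] by (simp add: armijo_condition_def \<rho>_Suc g_def)
    then have "F (\<rho> (Suc k)) \<le> F (\<rho> k) + \<tau> * (g k \<bullet> (\<rho> (Suc k) - \<rho> k))"
      using F[OF subsetD[OF dom k(2)]] F[OF subsetD[OF dom new_nonsing]] by simp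
    moreover have "0 \<le> g k \<bullet> (\<rho> k - \<rho> (Suc k))"
      using eg_update_descent_nonneg[OF k(2) herm[OF k(2), unfolded g_def] pos]
      by (simp add: \<rho>_Suc g_def)
    ultimately show ?thesis
      using new_nonsing by (simp add: inner_diff_right algebra_simps)
  qed
  have mono_step: "f (\<rho> (Suc k)) \<le> f (\<rho> k)"
    if k: "\<rho> k \<in> S" "\<rho> k \<in> nonsingular_density_matrices" for k
  proof -
    have "0 \<le> \<tau> * (g k \<bullet> (\<rho> k - \<rho> (Suc k)))"
      using descent[OF k] \<open>0 < \<tau>\<close> by simp
    then show ?thesis
      using descent[OF k] F[OF subsetD[OF dom k(2)]] F[of "\<rho> (Suc k)"] dom by auto
  qed
  have inv: "\<rho> k \<in> S \<and> \<rho> k \<in> nonsingular_density_matrices" for k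
  proof (induction k)
    case 0
    then show ?case
      using assms(11) nonsing by (simp add: \<rho>_def S_def)
  next
    case (Suc k)
    then have "f (\<rho> (Suc k)) \<le> f \<rho>\<^sub>0"
      using mono_step[of k] by (auto simp: S_def)
    then show ?case
      using Suc descent[of k] nonsing by (simp add: S_def)
  qed
  have minimal: "\<not> f \<sigma> < f l" if l: "seq_limit_point \<rho> l" and \<sigma>: "\<sigma> \<in> density_matrices" for l \<sigma>
  proof
    assume less: "f \<sigma> < f l"
    obtain s where s: "strict_mono s" "(\<rho> \<circ> s) \<longlonglongrightarrow> l"
      using l by (auto simp: seq_limit_point_def)
    have "l \<in> S"
      using seq_limit_point_in_compact[OF \<open>compact S\<close> _ l] inv by blast
    have "(\<lambda>j. f ((\<rho> \<circ> s) j)) \<longlonglongrightarrow> f l"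
      using \<open>l \<in> S\<close> inv by (intro continuous_on_tendsto_compose[OF cont s(2)]) (auto simp: S_def)
    moreover have "decseq (\<lambda>k. f (\<rho> k))"
      using mono_step inv by (intro decseq_SucI) blast
    ultimately have limit_le: "f l \<le> f (\<rho> k)" for k
    proof -
      have "f ((\<rho> \<circ> s) j) \<le> f (\<rho> k)" if "j \<ge> k" for j
        using \<open>decseq (\<lambda>k. f (\<rho> k))\<close> seq_suble[OF s(1), of j] that by (auto simp: decseq_def)
      then show ?thesis
        by (intro LIMSEQ_le_const2[OF \<open>(\<lambda>j. f ((\<rho> \<circ> s) j)) \<longlonglongrightarrow> f l\<close>]) blast
    qed
    have dom_l: "l \<in> edom f" and dom_k: "\<rho> k \<in> edom f" for k
      using \<open>l \<in> S\<close> inv S_dom by auto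
    have dom_\<sigma>: "\<sigma> \<in> edom f"
      using less \<sigma> by (auto simp: edom_def density_matrices_def pos_semidef_def)
    define c where "c = F l - F \<sigma>"
    have "c > 0"
      using less F[OF dom_l] F[OF dom_\<sigma>] by (simp add: c_def)
    have Fl: "F l \<le> F (\<rho> k)" for k
      using limit_le[of k] F[OF dom_l] F[OF dom_k] by simp
    \<comment> \<open>The weight \<open>\<alpha> / \<tau>\<close> makes the actual decrease of \<open>f\<close> pay for the error term \<open>\<beta> k * \<Delta>\<close> of the
      mirror inequality, since \<open>\<beta> k \<le> \<alpha>\<close>.\<close>
    define W where "W k = - (\<sigma> \<bullet> mat_log (\<rho> k)) + \<alpha> / \<tau> * F (\<rho> k)" for k
    have W_Suc: "W (Suc k) \<le> W k - \<beta>\<^sub>0 * c" for k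
    proof -
      define \<Delta> where "\<Delta> = g k \<bullet> (\<rho> k - \<rho> (Suc k))"
      have k: "\<rho> k \<in> S" "\<rho> k \<in> nonsingular_density_matrices"
        using inv by auto
      have \<Delta>: "\<Delta> \<ge> 0" "F (\<rho> (Suc k)) \<le> F (\<rho> k) - \<tau> * \<Delta>"
        using descent[OF k] by (auto simp: \<Delta>_def)
      have \<beta>: "\<beta>\<^sub>0 \<le> \<beta> k" "\<beta> k \<le> \<alpha>"
        using search[OF k] by auto
      have "g k \<bullet> (\<sigma> - \<rho> k) \<le> - c"
        using gradient_inequality[OF cvx cd dom_k dom_\<sigma>, of k] Fl[of k]
        by (simp add: g_def c_def F_def)
      then have "g k \<bullet> (\<sigma> - \<rho> (Suc k)) \<le> \<Delta> - c"
        by (simp add: \<Delta>_def inner_diff_right)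
      then have "\<beta> k * (g k \<bullet> (\<sigma> - \<rho> (Suc k))) \<le> \<beta> k * (\<Delta> - c)"
        using \<beta> \<open>\<beta>\<^sub>0 > 0\<close> by (intro mult_left_mono) auto
      then have step_le: "- (\<sigma> \<bullet> mat_log (\<rho> (Suc k))) \<le> - (\<sigma> \<bullet> mat_log (\<rho> k)) + \<beta> k * (\<Delta> - c)"
        using eg_update_mirror_inequality[OF k(2) herm[OF k(2), unfolded g_def] \<sigma>, of "\<beta> k"]
        unfolding \<rho>_Suc g_def by linarith
      moreover have "\<beta> k * (\<Delta> - c) \<le> \<alpha> * \<Delta> - \<beta>\<^sub>0 * c"
        using mult_right_mono[OF \<beta>(2) \<Delta>(1)] mult_right_mono[OF \<beta>(1) less_imp_le[OF \<open>c > 0\<close>]]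
        by (simp add: algebra_simps)
      moreover have "\<alpha> / \<tau> * F (\<rho> (Suc k)) \<le> \<alpha> / \<tau> * F (\<rho> k) - \<alpha> * \<Delta>"
        using mult_left_mono[OF \<Delta>(2), of "\<alpha> / \<tau>"] \<open>\<alpha> > 0\<close> \<open>0 < \<tau>\<close>
        by (simp add: right_diff_distrib)
      ultimately show ?thesis
        using step_le unfolding W_def by linarith
    qed
    have W_upper: "W k \<le> W 0 - real k * (\<beta>\<^sub>0 * c)" for k
    proof (induction k)
      case (Suc k)
      then show ?case
        using W_Suc[of k] by (simp add: algebra_simps)
    qed simp
    have W_lower: "\<alpha> / \<tau> * F l - ln 2 \<le> W k" for k
      using inner_mat_log_upper_bound[OF \<sigma>, of "\<rho> k"] inv[of k]
        mult_left_mono[OF Fl, of "\<alpha> / \<tau>" k] \<open>\<alpha> > 0\<close> \<open>0 < \<tau>\<close>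
      by (simp add: W_def)
    obtain k where "W 0 - (\<alpha> / \<tau> * F l - ln 2) < real k * (\<beta>\<^sub>0 * c)"
      using reals_Archimedean3[of "\<beta>\<^sub>0 * c"] \<open>\<beta>\<^sub>0 > 0\<close> \<open>c > 0\<close> by auto
    with W_upper[of k] W_lower[of k] show False
      by linarith
  qed
  have in_D: "\<rho> k \<in> density_matrices" for k
    using inv nonsing by blast
  have "\<exists>l. seq_limit_point \<rho> l"
    using compact_imp_seq_compact[OF compact_density_matrices] in_D
    unfolding seq_compact_def seq_limit_point_def by metis
  moreover have "l \<in> density_matrices" if "seq_limit_point \<rho> l" for l
    using seq_limit_point_in_compact[OF compact_density_matrices in_D that] .
  ultimately show ?thesis
    using search mono_step inv in_D minimal unfolding is_arg_min_def by blast
qed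

end
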